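(* Let $J_1=(-1,1)$ and $T\in(0,\infty]$. Let $u\in C^\infty_{\mathrm{loc}}(J_1\times[0,T))$ be a Graphical Curve Shortening Flow starting from $u_0:=u(\cdot,0)\in L^1(J_1)$, and suppose that $$t_\star:=\frac{\|u_0\|_{L^1(J_1)}}{\pi}=\frac1\pi\int_{J_1}|u_0(x)|\,dx<T.$$ Then for all $\delta>0$ there exists a constant $C=C(\delta)<\infty$ (depending only on $\delta$) such that the bound $$|u(0,t)|\le C+\frac12\|u_0\|_{L^1(J_1)}+\frac{\pi t}{2}$$ holds for all $t<T$ satisfying $t\ge(1+\delta)\,t_\star$.
   Context: For an interval $J\subseteq\mathbb{R}$, a Graphical Curve Shortening Flow (GCSF) is a smooth real-valued function $u$ of $(x,t)\in J\times(0,T)$ satisfying $\partial_t u=\dfrac{\partial_x^2u}{1+(\partial_xu)^2}=\partial_x[\tan^{-1}(\partial_xu)]$. The notation $u\in C^\infty_{\mathrm{loc}}(J_1\times[0,T))$ means that $u$ is smooth on $J_1\times[0,T)$, including up to the initial time $t=0$ (locally in $J_1$; no boundedness or regularity is assumed at $x=\pm1$). *)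

theory Defs
  imports "HOL-Analysis.Analysis"
begin

text \<open>Derivatives are taken relative to \<open>S\<close>, so boundary points belonging to \<open>S\<close> are included
  (one-sided derivatives there). When \<open>S\<close> is convex with nonempty interior, as below, the derivative
  within \<open>S\<close> is unique, so the existential determines \<open>f'\<close> on \<open>S\<close>.\<close>

fun Ck_on :: "nat \<Rightarrow> 'a::real_normed_vector set \<Rightarrow> ('a \<Rightarrow> 'b::real_normed_vector) \<Rightarrow> bool" where
  "Ck_on 0 S f \<longleftrightarrow> continuous_on S f"
| "Ck_on (Suc k) S f \<longleftrightarrow>
     (\<exists>f'. (\<forall>p\<in>S. (f has_derivative f' p) (at p within S)) \<and> (\<forall>v. Ck_on k S (\<lambda>p. f' p v)))"

definition smooth_on :: "'a::euclidean_space set \<Rightarrow> ('a \<Rightarrow> 'b::real_normed_vector) \<Rightarrow> bool" where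
  "smooth_on S f \<longleftrightarrow> (\<forall>k. Ck_on k S f)"

text \<open>The equation is stated relationally: \<open>ux\<close> and \<open>uxx\<close> are the first and second spatial
  derivatives. The lifetime \<open>T\<close> may be \<open>\<infinity>\<close>.\<close>

definition GCSF :: "real set \<Rightarrow> ereal \<Rightarrow> (real \<times> real \<Rightarrow> real) \<Rightarrow> bool" where
  "GCSF J T u \<longleftrightarrow>
     is_interval J \<and> interior J \<noteq> {} \<and>
     smooth_on (J \<times> {t. 0 < t \<and> ereal t < T}) u \<and>
     (\<exists>ux uxx. \<forall>x\<in>J. \<forall>t. 0 < t \<and> ereal t < T \<longrightarrow>
        ((\<lambda>y. u (y, t)) has_real_derivative ux (x, t)) (at x within J) \<and>
        ((\<lambda>y. ux (y, t)) has_real_derivative uxx (x, t)) (at x within J) \<and>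
        ((\<lambda>s. u (x, s)) has_real_derivative uxx (x, t) / (1 + (ux (x, t))\<^sup>2)) (at t))"

definition L1_norm_on :: "real set \<Rightarrow> (real \<Rightarrow> real) \<Rightarrow> real" where
  "L1_norm_on J f = (LBINT x:J. \<bar>f x\<bar>)"

end

theory Submission
  imports Defs
begin

text \<open>A flow \<open>u\<close> has a potential \<open>ph\<close> with \<open>ph\<^sub>x = u\<close> and \<open>ph\<^sub>t = \<psi> = arctan u\<^sub>x\<close>, normalised so that
  \<open>\<bar>ph\<bar> \<le> A / 2\<close> initially (\<open>A\<close> is the \<open>L\<^sup>1\<close> norm of \<open>u\<^sub>0\<close>), hence \<open>\<bar>ph\<bar> \<le> H := A / 2 + \<pi> t / 2\<close> at time
  \<open>t\<close>, with no assumption at the boundary. Put \<open>w = ph - H x\<close> and \<open>v = w\<^sub>x = u - H\<close>; then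
  \<open>w \<ge> 0\<close> in the limit \<open>x \<rightarrow> -1\<close>, and one has to bound \<open>v\<close> from above at \<open>x = 0\<close>. By reflection assume
  \<open>w \<le> 0\<close> at \<open>x = 0\<close>. If \<open>u\<^sub>x\<close> is bounded above to the left of \<open>0\<close> wherever \<open>w \<le> 0\<close> and \<open>v\<close> is not very
  negative, then a large \<open>v\<close> persists to the left and forces \<open>w < 0\<close> at \<open>x = -1\<close>.

  The bound on \<open>u\<^sub>x\<close> is a Harnack-type estimate: where \<open>\<psi>\<close> is close to \<open>\<pi> / 2\<close>, the potential must have been
  rising at nearly full speed, so \<open>w\<close> cannot be \<open>\<le> 0\<close> any more after time \<open>(1 + \<delta>) A / \<pi>\<close>. It comes from the
  maximum principle for \<open>\<psi>\<close> plus a small multiple of \<open>-w\<close> and a localising paraboloid, using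
  \<open>\<psi>\<^sub>t = (cos \<psi>)\<^sup>2 \<psi>\<^sub>x\<^sub>x\<close>. Applied on the whole of \<open>[0, t]\<close> it loses a term of order \<open>sqrt t\<close>. On a window of
  length comparable to an error \<open>E\<close> already known, it reduces \<open>E\<close> to order \<open>sqrt E\<close> (up to the loss from
  shrinking the interval), so iterating it over shorter and shorter windows leaves a constant.\<close>

section \<open>Calculus\<close>

text \<open>As \<open>f''\<close> is known at \<open>x\<close> only, the argument runs through
  \<open>f'\<close>: it vanishes at \<open>x\<close> and, if \<open>f'' > 0\<close>, is positive
  just to the right, where \<open>f\<close> would then increase.\<close>

lemma max_imp_second_derivative_nonpos:
  fixes f f' :: "real \<Rightarrow> real"
  assumes d: "d > 0"
    and f: "\<And>y. \<bar>y - x\<bar> < d \<Longrightarrow> (f has_real_derivative f' y) (at y)"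
    and f': "(f' has_real_derivative f'') (at x)"
    and max: "\<And>y. \<bar>y - x\<bar> < d \<Longrightarrow> f y \<le> f x"
  shows "f'' \<le> 0"
proof (rule ccontr)
  assume "\<not> f'' \<le> 0"
  then obtain e where e: "e > 0" "\<And>h. 0 < h \<Longrightarrow> h < e \<Longrightarrow> f' x < f' (x + h)"
    using DERIV_pos_inc_right[OF f'] by force
  have 0: "f' x = 0"
    by (rule DERIV_local_max[OF f d]) (use d max in \<open>auto simp: abs_minus_commute\<close>)
  define h where "h = min d e / 2"
  have h: "0 < h" "h < d" "h < e" using d e(1) by (auto simp: h_def)
  have "f x < f (x + h)"
  proof (rule DERIV_pos_imp_increasing_open[where f = f])
    show "x < x + h" using h by simp
    show "\<exists>z. (f has_real_derivative z) (at y) \<and> 0 < z" if "x < y" "y < x + h" for y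
      using f[of y] e(2)[of "y - x"] that h 0 by (intro exI[of _ "f' y"]) auto
    show "continuous_on {x..x + h} f"
      by (rule DERIV_continuous_on, rule has_field_derivative_at_within, rule f) (use h in auto)
  qed
  then show False using max[of "x + h"] h by simp
qed

text \<open>Only earlier times are compared, since the maximum may lie at the final time of a
  parabolic box.\<close>

lemma max_imp_time_derivative_nonneg:
  fixes f :: "real \<Rightarrow> real"
  assumes f: "(f has_real_derivative l) (at t)" and "s < t"
    and max: "\<And>y. s \<le> y \<Longrightarrow> y \<le> t \<Longrightarrow> f y \<le> f t"
  shows "0 \<le> l"
proof (rule ccontr)
  assume "\<not> 0 \<le> l"
  then obtain e where e: "e > 0" "\<And>h. 0 < h \<Longrightarrow> h < e \<Longrightarrow> f t < f (t - h)"
    using DERIV_neg_dec_left[OF f] by force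
  define h where "h = min (e / 2) (t - s)"
  have "0 < h" "h < e" "h \<le> t - s" using e(1) \<open>s < t\<close> by (auto simp: h_def)
  then show False using max[of "t - h"] e(2)[of h] by simp
qed

text \<open>A concave smoothing of \<open>min z 0\<close>. What the barrier needs is \<open>- softmin'' \<le> softmin'\<close>, which lets the
  drift \<open>- \<pi> / 2\<close> of \<open>v\<close> beat the concavity.\<close>

definition softmin :: "real \<Rightarrow> real" where
  "softmin z = - ln (1 + exp (- z))"

definition softmin' :: "real \<Rightarrow> real" where
  "softmin' z = exp (- z) / (1 + exp (- z))"

definition softmin'' :: "real \<Rightarrow> real" where
  "softmin'' z = - exp (- z) / (1 + exp (- z))\<^sup>2"

lemma one_plus_exp_pos: "0 < 1 + exp (z::real)"
  by (simp add: add_pos_pos)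

lemma softmin_deriv:
  "(softmin has_real_derivative softmin' z) (at z)"
  "(softmin' has_real_derivative softmin'' z) (at z)"
proof -
  have p: "0 < 1 + exp (- z)" by (rule one_plus_exp_pos)
  show "(softmin has_real_derivative softmin' z) (at z)"
    unfolding softmin_def[abs_def] softmin'_def using p
    by (auto intro!: derivative_eq_intros simp: field_simps)
  show "(softmin' has_real_derivative softmin'' z) (at z)"
    unfolding softmin'_def[abs_def] softmin''_def using p
    by (auto intro!: derivative_eq_intros simp: field_simps power2_eq_square)
qed

lemma softmin_deriv_chain [derivative_intros]:
  assumes "(f has_real_derivative f') (at x within S)"
  shows "((\<lambda>x. softmin (f x)) has_real_derivative softmin' (f x) * f') (at x within S)"
    and "((\<lambda>x. softmin' (f x)) has_real_derivative softmin'' (f x) * f') (at x within S)"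
  using DERIV_chain2[OF softmin_deriv(1) assms] DERIV_chain2[OF softmin_deriv(2) assms] by auto

lemma continuous_on_softmin [continuous_intros]:
  "continuous_on S f \<Longrightarrow> continuous_on S (\<lambda>x. softmin (f x))"
  unfolding softmin_def by (intro continuous_intros) (simp_all add: add_nonneg_eq_0_iff)

lemma softmin'_pos: "0 < softmin' z"
  using one_plus_exp_pos by (simp add: softmin'_def)

lemma softmin''_ge: "- softmin' z \<le> softmin'' z"
proof -
  have "exp (- z) / (1 + exp (- z))\<^sup>2 \<le> exp (- z) / (1 + exp (- z))"
    by (rule divide_left_mono) (auto simp: power2_eq_square one_plus_exp_pos)
  then show ?thesis by (simp add: softmin'_def softmin''_def)
qed

lemma softmin_le: "softmin z \<le> 0" "softmin z \<le> z"
proof -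
  show "softmin z \<le> 0" by (simp add: softmin_def)
  have "ln (exp (- z)) \<le> ln (1 + exp (- z))"
    using one_plus_exp_pos by (subst ln_le_cancel_iff) auto
  then show "softmin z \<le> z" by (simp add: softmin_def)
qed

text \<open>The smoothing costs at most \<open>ln 2\<close>, rounded up to \<open>1\<close> through
  \<open>2 \<le> exp 1\<close>.\<close>

lemma softmin_ge: "min z 0 - 1 \<le> softmin z"
proof -
  have "1 + exp (- z) \<le> 2 * exp (- min z 0)"
    by (auto simp: min_def)
  also have "\<dots> \<le> exp 1 * exp (- min z 0)"
    using exp_ge_add_one_self[of 1] by (intro mult_right_mono) auto
  finally have "ln (1 + exp (- z)) \<le> ln (exp 1 * exp (- min z 0))"
    using one_plus_exp_pos by (subst ln_le_cancel_iff) auto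
  then show ?thesis by (simp add: softmin_def flip: exp_add)
qed

text \<open>The cosine of \<open>arctan D\<close> is the sine of the gap
  \<open>pi / 2 - arctan D\<close>, hence at most the gap; the left sides are its square and its
  product with the sine. In the barrier this makes the diffusion coefficient quadratically small in
  the gap.\<close>

lemma arctan_complement_bounds:
  fixes D :: real
  assumes "0 \<le> D"
  shows "1 / (1 + D\<^sup>2) \<le> (pi / 2 - arctan D)\<^sup>2" "D / (1 + D\<^sup>2) \<le> pi / 2 - arctan D"
proof -
  let ?y = "arctan D" and ?g = "pi / 2 - arctan D"
  have y: "0 \<le> ?y" "?y < pi / 2" using assms arctan_ubound by auto
  have c: "cos ?y = sin ?g" by (simp add: sin_diff)
  have c0: "0 < cos ?y" using cos_arctan_not_zero[of D] cos_ge_zero[of ?y] y by linarith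
  have cg: "cos ?y \<le> ?g" unfolding c by (rule sin_x_le_x) (use y in auto)
  have sq: "(cos ?y)\<^sup>2 = 1 / (1 + D\<^sup>2)"
    by (simp add: cos_arctan power_divide)
  show "1 / (1 + D\<^sup>2) \<le> ?g\<^sup>2"
    unfolding sq[symmetric] using c0 cg by (intro power_mono) auto
  have "D / (1 + D\<^sup>2) = sin ?y * cos ?y"
    by (simp add: sin_arctan cos_arctan)
  also have "\<dots> \<le> 1 * cos ?y" using c0 by (intro mult_right_mono) auto
  finally show "D / (1 + D\<^sup>2) \<le> ?g" using cg by linarith
qed

text \<open>For \<open>D > 0\<close>, \<open>pi / 2 - arctan D = arctan (1 / D) \<le> 1 / D\<close>.
  This turns a gap in the angle into a bound on the slope.\<close>

lemma le_inverse_of_arctan_le: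
  fixes D y :: real
  assumes y: "0 < y" and le: "arctan D \<le> pi / 2 - y"
  shows "D \<le> 1 / y"
proof (cases "D \<le> 0")
  case True
  then show ?thesis using y by (meson divide_nonneg_pos order_trans zero_le_one less_imp_le)
next
  case False
  then have D: "0 < D" by simp
  have "arctan (1 / D) = pi / 2 - arctan D"
    using arctan_inverse[of D] D by (simp add: sgn_if inverse_eq_divide)
  moreover have "arctan (1 / D) \<le> 1 / D"
    by (rule arctan_le_self) (use D in auto)
  ultimately have "y \<le> 1 / D" using le by linarith
  then show ?thesis using y D by (simp add: field_simps)
qed

text \<open>The function \<open>q y = - w y + (1 + y) * v y\<close> has derivative
  \<open>(1 + y) * D y\<close>, because the terms in \<open>v\<close> cancel. If \<open>q x\<close>
  exceeded \<open>2 * K\<close>, both \<open>q\<close> and \<open>- w\<close> would stay above a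
  fixed positive level all the way to \<open>-1\<close>, which \<open>lower\<close>
  excludes.\<close>

lemma slope_bound_of_slice:
  fixes w v D :: "real \<Rightarrow> real"
  assumes x: "- 1 < x" "x \<le> 1" and K: "0 \<le> K"
    and w: "\<And>y. - 1 < y \<Longrightarrow> y \<le> x \<Longrightarrow> (w has_real_derivative v y) (at y)"
    and v: "\<And>y. - 1 < y \<Longrightarrow> y \<le> x \<Longrightarrow> (v has_real_derivative D y) (at y)"
    and lower: "\<And>y. - 1 < y \<Longrightarrow> y \<le> x \<Longrightarrow> - w y \<le> L * (1 + y)"
    and D: "\<And>y. - 1 < y \<Longrightarrow> y \<le> x \<Longrightarrow> w y \<le> 0 \<Longrightarrow> 0 \<le> - w y + (1 + y) * v y \<Longrightarrow> (1 + y) * D y \<le> K"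
    and wx: "w x < 0"
  shows "- w x + (1 + x) * v x \<le> 2 * K"
proof (rule ccontr)
  define q where "q y = - w y + (1 + y) * v y" for y
  assume "\<not> ?thesis"
  then have qx: "q x > 2 * K" by (simp add: q_def)
  define e where "e = min (- w x) (q x - 2 * K)"
  have e: "0 < e" "e \<le> - w x" "e \<le> q x - 2 * K" using wx qx by (auto simp: e_def)
  have q: "(q has_real_derivative (1 + y) * D y) (at y)" if "- 1 < y" "y \<le> x" for y
    unfolding q_def[abs_def] using w[OF that] v[OF that]
    by (auto intro!: derivative_eq_intros simp: algebra_simps)
  have contw: "continuous_on {z..x} w" and contv: "continuous_on {z..x} v"
    and contq: "continuous_on {z..x} q" if "- 1 < z" for z
  proof -
    have *: "- 1 < y" "y \<le> x" if "y \<in> {z..x}" for y using that \<open>- 1 < z\<close> by auto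
    show "continuous_on {z..x} w"
      by (rule DERIV_continuous_on) (rule has_field_derivative_at_within, rule w, (rule *, assumption)+)
    show "continuous_on {z..x} v"
      by (rule DERIV_continuous_on) (rule has_field_derivative_at_within, rule v, (rule *, assumption)+)
    show "continuous_on {z..x} q"
      by (rule DERIV_continuous_on) (rule has_field_derivative_at_within, rule q, (rule *, assumption)+)
  qed
  text \<open>As long as the hypothesis on \<open>D\<close> applies, \<open>q\<close> loses at most \<open>2 K\<close> on the way to the left,
    and \<open>- w\<close> can only decrease where \<open>v < 0\<close>, that is, where \<open>q \<le> - w\<close>.\<close>
  have step: "e \<le> q y \<and> e \<le> - w y"
    if z: "- 1 < z" and pos: "\<And>y. z \<le> y \<Longrightarrow> y \<le> x \<Longrightarrow> 0 \<le> q y \<and> 0 \<le> - w y" and y: "z \<le> y" "y \<le> x"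
    for z y
  proof -
    have eq: "e \<le> q y" if y: "z \<le> y" "y \<le> x" for y
    proof (cases "y = x")
      case True
      then show ?thesis using e K by auto
    next
      case False
      then have "y < x" using y by simp
      then obtain c where c: "y < c" "c < x" "q x - q y = (x - y) * ((1 + c) * D c)"
        using MVT2[of y x q "\<lambda>y. (1 + y) * D y"] q y z by auto
      have "(1 + c) * D c \<le> K" using D[of c] pos[of c] c y z by (auto simp: q_def)
      then have "q x - q y \<le> (x - y) * K"
        unfolding c using \<open>y < x\<close> by (intro mult_left_mono) auto
      also have "\<dots> \<le> 2 * K" using x y z K by (intro mult_right_mono) auto
      finally show ?thesis using e by linarith
    qed
    have "e \<le> - w y"
    proof (cases "v y \<le> 0")
      case True
      have "(1 + y) * v y \<le> 0" using True y z by (simp add: mult_nonneg_nonpos)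
      then show ?thesis using eq[OF y] by (simp add: q_def)
    next
      case vy: False
      \<comment> \<open>At the first point \<open>y2\<close> to the right of \<open>y\<close> with
        \<open>v \<le> 0\<close>, \<open>q \<le> - w\<close>. Since \<open>w\<close> is
        nondecreasing up to there, \<open>- w y \<ge> - w y2 \<ge> q y2 \<ge> e\<close>. If there is
        no such point, \<open>x\<close> takes its place.\<close>
      define Z where "Z = {y' \<in> {y..x}. v y' \<le> 0}"
      show ?thesis
      proof (cases "Z = {}")
        case True
        have "w y \<le> w x"
        proof (rule DERIV_nonneg_imp_nondecreasing[where f = w])
          show "y \<le> x" by fact
          show "\<exists>d. (w has_real_derivative d) (at t) \<and> 0 \<le> d" if "y \<le> t" "t \<le> x" for t
            using True that w[of t] y z by (intro exI[of _ "v t"]) (force simp: Z_def)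
        qed
        then show ?thesis using e by linarith
      next
        case False
        have "continuous_on {y..x} v" using contv[of y] y z by auto
        then have "closed Z" unfolding Z_def by (intro continuous_on_closed_Collect_le) auto
        moreover have bdd: "bdd_below Z" by (auto simp: Z_def bdd_below_def)
        ultimately have Z: "Inf Z \<in> Z" using False by (intro closed_contains_Inf)
        define y2 where "y2 = Inf Z"
        have y2: "y \<le> y2" "y2 \<le> x" "v y2 \<le> 0" using Z by (auto simp: Z_def y2_def)
        have "w y \<le> w y2"
        proof (rule DERIV_nonneg_imp_increasing_open[where f = w])
          show "y \<le> y2" by fact
          show "\<exists>d. (w has_real_derivative d) (at t) \<and> 0 \<le> d" if "y < t" "t < y2" for t
          proof -
            have "t \<notin> Z" using that cInf_lower[OF _ bdd, of t] by (auto simp: y2_def)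
            then show ?thesis using that w[of t] y y2 z by (intro exI[of _ "v t"]) (force simp: Z_def)
          qed
          show "continuous_on {y..y2} w" using contw[of y] y z y2 by (auto elim: continuous_on_subset)
        qed
        moreover have "(1 + y2) * v y2 \<le> 0" using y2 y z by (simp add: mult_nonneg_nonpos)
        ultimately show ?thesis using eq[of y2] y2 y by (simp add: q_def)
      qed
    qed
    then show ?thesis using eq[OF y] by simp
  qed
  have all: "e / 2 < q y \<and> e / 2 < - w y" if y: "- 1 < y" "y \<le> x" for y
  proof (rule ccontr)
    assume neg: "\<not> ?thesis"
    \<comment> \<open>Continuity argument: at the rightmost point where the smaller of
      \<open>q\<close> and \<open>- w\<close> is at most \<open>e / 2\<close>, both are still
      nonnegative from there to \<open>x\<close>, so \<open>step\<close> lifts them to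
      \<open>e\<close>, a contradiction.\<close>
    define B where "B = {y' \<in> {y..x}. min (q y') (- w y') \<le> e / 2}"
    have "B \<noteq> {}" using neg y by (auto simp: B_def min_def intro!: exI[of _ y])
    moreover have "continuous_on {y..x} (\<lambda>t. min (q t) (- w t))"
      by (intro continuous_intros contq contw y)
    then have "closed B" unfolding B_def by (intro continuous_on_closed_Collect_le) auto
    moreover have bdd: "bdd_above B" by (auto simp: B_def bdd_above_def)
    ultimately have zB: "Sup B \<in> B" by (intro closed_contains_Sup)
    define z where "z = Sup B"
    have z: "y \<le> z" "z \<le> x" "min (q z) (- w z) \<le> e / 2" using zB by (auto simp: B_def z_def)
    have right: "e / 2 < min (q t) (- w t)" if "z < t" "t \<le> x" for t
    proof -
      have "t \<notin> B" using that cSup_upper[OF _ bdd, of t] by (auto simp: z_def)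
      then show ?thesis using that z y by (auto simp: B_def)
    qed
    have zx: "z < x" using z e K by (cases "z = x") (auto simp: min_def split: if_splits)
    have "e / 2 \<le> min (q z) (- w z)"
    proof (rule ccontr)
      assume "\<not> ?thesis"
      then have lt: "min (q z) (- w z) < e / 2" by (rule not_le_imp_less)
      have cont: "continuous_on {z..x} (\<lambda>t. min (q t) (- w t))"
        using contq[of z] contw[of z] z y by (auto intro!: continuous_intros)
      have "\<exists>t\<ge>z. t \<le> x \<and> min (q t) (- w t) = e / 2"
        by (rule IVT') (use lt right[of x] zx cont in auto)
      then obtain t where "z \<le> t" "t \<le> x" "min (q t) (- w t) = e / 2" by auto
      then show False using right[of t] lt by (cases "t = z") auto
    qed
    then have "e / 2 \<le> min (q t) (- w t)" if "z \<le> t" "t \<le> x" for t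
      using right[of t] that by (cases "t = z") auto
    then have "0 \<le> q t \<and> 0 \<le> - w t" if "z \<le> t" "t \<le> x" for t
      using that e(1) by (smt (verit) min.bounded_iff half_gt_zero)
    then have "e \<le> q z \<and> e \<le> - w z" using step[of z z] z y by auto
    then show False using z(3) e(1) by (auto simp: min_def split: if_splits)
  qed
  \<comment> \<open>A point so close to \<open>-1\<close> that \<open>lower\<close> yields
    \<open>- w y \<le> e / 2\<close>.\<close>
  define y where "y = min x (- 1 + min 1 (e / (2 * (\<bar>L\<bar> + 1))))"
  have y: "- 1 < y" "y \<le> x" "1 + y \<le> e / (2 * (\<bar>L\<bar> + 1))"
  proof -
    have "0 < e / (2 * (\<bar>L\<bar> + 1))" using e(1) by simp
    then show "- 1 < y" "y \<le> x" "1 + y \<le> e / (2 * (\<bar>L\<bar> + 1))"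
      using x unfolding y_def by linarith+
  qed
  have "L * (1 + y) \<le> (\<bar>L\<bar> + 1) * (e / (2 * (\<bar>L\<bar> + 1)))"
    using y by (intro mult_mono) auto
  also have "\<dots> = e / 2" by (simp add: field_simps)
  finally show False using all[OF y(1,2)] lower[OF y(1,2)] by linarith
qed

section \<open>A barrier for the slope\<close>

text \<open>\<open>ph\<close> is a potential of the flow: \<open>ph\<^sub>x = u\<close> and \<open>ph\<^sub>t = arctan u\<^sub>x\<close>. The equation enters
  through \<open>u\<^sub>x\<^sub>x = (1 + u\<^sub>x\<^sup>2) u\<^sub>t\<close>.\<close>

locale flow_potential =
  fixes Tm A :: real and ph u ux ut uxt :: "real \<Rightarrow> real \<Rightarrow> real"
  assumes ph_x: "\<And>x t. - 1 < x \<Longrightarrow> x < 1 \<Longrightarrow> 0 < t \<Longrightarrow> t < Tm \<Longrightarrow>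
      ((\<lambda>y. ph y t) has_real_derivative u x t) (at x)"
    and ph_t: "\<And>x t. - 1 < x \<Longrightarrow> x < 1 \<Longrightarrow> 0 < t \<Longrightarrow> t < Tm \<Longrightarrow>
      ((\<lambda>s. ph x s) has_real_derivative arctan (ux x t)) (at t)"
    and u_x: "\<And>x t. - 1 < x \<Longrightarrow> x < 1 \<Longrightarrow> 0 < t \<Longrightarrow> t < Tm \<Longrightarrow>
      ((\<lambda>y. u y t) has_real_derivative ux x t) (at x)"
    and u_t: "\<And>x t. - 1 < x \<Longrightarrow> x < 1 \<Longrightarrow> 0 < t \<Longrightarrow> t < Tm \<Longrightarrow>
      ((\<lambda>s. u x s) has_real_derivative ut x t) (at t)"
    and ux_x: "\<And>x t. - 1 < x \<Longrightarrow> x < 1 \<Longrightarrow> 0 < t \<Longrightarrow> t < Tm \<Longrightarrow>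
      ((\<lambda>y. ux y t) has_real_derivative (1 + (ux x t)\<^sup>2) * ut x t) (at x)"
    and ux_t: "\<And>x t. - 1 < x \<Longrightarrow> x < 1 \<Longrightarrow> 0 < t \<Longrightarrow> t < Tm \<Longrightarrow>
      ((\<lambda>s. ux x s) has_real_derivative uxt x t) (at t)"
    and ut_x: "\<And>x t. - 1 < x \<Longrightarrow> x < 1 \<Longrightarrow> 0 < t \<Longrightarrow> t < Tm \<Longrightarrow>
      ((\<lambda>y. ut y t) has_real_derivative uxt x t) (at x)"
    and cont: "continuous_on ({- 1<..<1} \<times> {0..<Tm}) (\<lambda>p. ph (fst p) (snd p))"
      "continuous_on ({- 1<..<1} \<times> {0..<Tm}) (\<lambda>p. u (fst p) (snd p))"
      "continuous_on ({- 1<..<1} \<times> {0..<Tm}) (\<lambda>p. ux (fst p) (snd p))"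
    and ph_bound: "\<And>x t. - 1 < x \<Longrightarrow> x < 1 \<Longrightarrow> 0 \<le> t \<Longrightarrow> t < Tm \<Longrightarrow> \<bar>ph x t\<bar> \<le> A / 2 + pi * t / 2"
begin

definition height :: "real \<Rightarrow> real" where
  "height t = A / 2 + pi * t / 2"

definition w :: "real \<Rightarrow> real \<Rightarrow> real" where
  "w x t = ph x t - height t * x"

definition v :: "real \<Rightarrow> real \<Rightarrow> real" where
  "v x t = u x t - height t"

text \<open>The only information near the boundary: as \<open>x\<close> tends to \<open>-1\<close>,
  \<open>w\<close> is nonnegative in the limit.\<close>

lemma w_lower: "- 1 < x \<Longrightarrow> x < 1 \<Longrightarrow> 0 \<le> t \<Longrightarrow> t < Tm \<Longrightarrow> - w x t \<le> height t * (1 + x)"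
  using ph_bound[of x t] by (simp add: w_def height_def ring_distribs abs_le_iff)

lemma w_x: "- 1 < x \<Longrightarrow> x < 1 \<Longrightarrow> 0 < t \<Longrightarrow> t < Tm \<Longrightarrow> ((\<lambda>y. w y t) has_real_derivative v x t) (at x)"
  unfolding w_def v_def by (auto intro!: derivative_eq_intros ph_x)

lemma w_t: "- 1 < x \<Longrightarrow> x < 1 \<Longrightarrow> 0 < t \<Longrightarrow> t < Tm \<Longrightarrow>
    ((\<lambda>s. w x s) has_real_derivative arctan (ux x t) - pi * x / 2) (at t)"
  unfolding w_def height_def by (auto intro!: derivative_eq_intros ph_t simp: algebra_simps)

lemma v_x: "- 1 < x \<Longrightarrow> x < 1 \<Longrightarrow> 0 < t \<Longrightarrow> t < Tm \<Longrightarrow> ((\<lambda>y. v y t) has_real_derivative ux x t) (at x)"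
  unfolding v_def by (auto intro!: derivative_eq_intros u_x)

lemma v_t: "- 1 < x \<Longrightarrow> x < 1 \<Longrightarrow> 0 < t \<Longrightarrow> t < Tm \<Longrightarrow>
    ((\<lambda>s. v x s) has_real_derivative ut x t - pi / 2) (at t)"
  unfolding v_def height_def by (auto intro!: derivative_eq_intros u_t simp: algebra_simps)

lemma cont_w: "continuous_on ({- 1<..<1} \<times> {0..<Tm}) (\<lambda>p. w (fst p) (snd p))"
  unfolding w_def height_def by (intro continuous_intros cont) auto

lemma cont_v: "continuous_on ({- 1<..<1} \<times> {0..<Tm}) (\<lambda>p. v (fst p) (snd p))"
  unfolding v_def height_def by (intro continuous_intros cont) auto

text \<open>At a positive maximum of \<open>Q = \<psi> - \<pi> / 2 + g P\<close> the boundary values of \<open>P\<close> exclude the parabolic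
  boundary, and \<open>Q\<^sub>t - (cos \<psi>)\<^sup>2 Q\<^sub>x\<^sub>x < 0\<close>: both \<open>cos \<psi>\<close> and \<open>\<pi> / 2 - \<psi>\<close> are small there, so \<open>- w\<close>
  decreases at a rate of almost \<open>\<pi> / 2 * (1 - x)\<close>, which exceeds \<open>kap\<close>.\<close>

lemma barrier:
  fixes b kap e ze c r t0 ta E :: real
  assumes kap: "0 \<le> kap" "kap \<le> 2" and e: "0 < e" "kap + e \<le> pi / 2 * (1 - b)" and ze: "0 \<le> ze"
    and r: "0 < r" "- 1 < c - r" "c + r \<le> b" "b < 1"
    and t: "0 \<le> t0" "0 < ta" "t0 + ta < Tm"
    and hyp: "\<And>x s. c - r \<le> x \<Longrightarrow> x \<le> c + r \<Longrightarrow> t0 \<le> s \<Longrightarrow> s \<le> t0 + ta \<Longrightarrow>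
        - w x s + ze * ((1 + x) * softmin (v x s)) \<le> E + 2 * (s - t0)"
    and Y: "0 < Y" "Y \<le> - w c (t0 + ta) + ze * ((1 + c) * softmin (v c (t0 + ta))) - E + kap * ta"
  shows "ux c (t0 + ta) \<le> 4 * ta / Y * (8 / e + 4 * sqrt ta / (r * sqrt e))"
proof -
  \<comment> \<open>\<open>xi * r\<^sup>2 = 4 * ta\<close> dominates \<open>(2 + kap) * ta\<close>,
    the bound on the rest of \<open>P\<close>, so \<open>P \<le> 0\<close> on the lateral sides; at
    time \<open>t0\<close> this is \<open>hyp\<close>.\<close>
  define xi where "xi = 4 * ta / r\<^sup>2"
  \<comment> \<open>An upper bound for \<open>g * P\<close>, and therefore for the gap
    \<open>pi / 2 - arctan (ux x s)\<close> at a positive maximum of \<open>Q\<close>. The two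
    entries keep the gap terms and the term of the paraboloid together below the reserve
    \<open>e\<close>.\<close>
  define gm where "gm = min (e / 8) (r * sqrt e / (4 * sqrt ta))"
  define g where "g = gm / (4 * ta)"
  define P where "P x s = - w x s + ze * ((1 + x) * softmin (v x s)) - E + kap * (s - t0) - xi * (x - c)\<^sup>2" for x s
  define Q where "Q x s = arctan (ux x s) - pi / 2 + g * P x s" for x s
  have e1: "e \<le> 4"
  proof -
    have "pi / 2 * (1 - b) \<le> pi / 2 * 2" using r by (intro mult_left_mono) auto
    then show ?thesis using e kap pi_less_4 e(2) by linarith
  qed
  have gm: "0 < gm" using e r t by (auto simp: gm_def)
  have g: "0 < g" using gm t by (auto simp: g_def)
  have xi: "0 \<le> xi" using t by (auto simp: xi_def)
  have gm2: "2 * gm + 2 * xi * gm\<^sup>2 < e"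
  proof -
    have "gm\<^sup>2 \<le> (r * sqrt e / (4 * sqrt ta))\<^sup>2" using gm by (intro power_mono) (auto simp: gm_def)
    also have "\<dots> = r\<^sup>2 * e / (16 * ta)" using e t by (simp add: power_divide power_mult_distrib)
    finally have "xi * gm\<^sup>2 \<le> xi * (r\<^sup>2 * e / (16 * ta))" using xi by (rule mult_left_mono)
    also have "\<dots> = e / 4" using r t by (simp add: xi_def field_simps)
    finally have "xi * gm\<^sup>2 \<le> e / 4" .
    moreover have "gm \<le> e / 8" by (simp add: gm_def)
    ultimately show ?thesis using e by linarith
  qed
  define B where "B = {c - r..c + r} \<times> {t0..t0 + ta}"
  have Bsub: "B \<subseteq> {- 1<..<1} \<times> {0..<Tm}" using r t by (auto simp: B_def)
  have "continuous_on B (\<lambda>p. Q (fst p) (snd p))"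
    unfolding Q_def P_def
    by (intro continuous_intros continuous_on_subset[OF cont(3) Bsub] continuous_on_subset[OF cont_w Bsub]
        continuous_on_subset[OF cont_v Bsub])
  moreover have "compact B" unfolding B_def by (intro compact_Times) auto
  moreover have "B \<noteq> {}" using r t by (auto simp: B_def)
  ultimately obtain p where p: "p \<in> B" "\<And>p'. p' \<in> B \<Longrightarrow> Q (fst p') (snd p') \<le> Q (fst p) (snd p)"
    using continuous_attains_sup[of B "\<lambda>p. Q (fst p) (snd p)"] by blast
  obtain x s where xs: "p = (x, s)" by (cases p)
  have x: "c - r \<le> x" "x \<le> c + r" and s: "t0 \<le> s" "s \<le> t0 + ta" using p(1) by (auto simp: xs B_def)
  have max: "Q x' s' \<le> Q x s" if "c - r \<le> x'" "x' \<le> c + r" "t0 \<le> s'" "s' \<le> t0 + ta" for x' s'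
    using p(2)[of "(x', s')"] that by (auto simp: xs B_def)
  have Qle: "Q x s \<le> 0"
  proof (rule ccontr)
    assume "\<not> ?thesis"
    then have Qpos: "0 < Q x s" by simp
    define D where "D = ux x s"
    define ga where "ga = pi / 2 - arctan D"
    have ga0: "0 < ga" using arctan_ubound[of D] by (simp add: ga_def)
    have gaP: "ga < g * P x s" using Qpos by (simp add: Q_def ga_def D_def)
    then have Ppos: "0 < P x s" using ga0 g by (meson less_trans zero_less_mult_pos)
    have h: "- w x s + ze * ((1 + x) * softmin (v x s)) \<le> E + 2 * (s - t0)" by (rule hyp[OF x s])
    have Pub: "P x s \<le> (2 + kap) * (s - t0) - xi * (x - c)\<^sup>2" using h by (simp add: P_def algebra_simps)
    have "(2 + kap) * (s - t0) \<le> 4 * ta" using kap s by (intro mult_mono) auto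
    then have Pub2: "P x s \<le> 4 * ta - xi * (x - c)\<^sup>2" using Pub by linarith
    have "s \<noteq> t0"
    proof
      assume "s = t0"
      moreover have "0 \<le> xi * (x - c)\<^sup>2" using xi by simp
      ultimately show False using Pub Ppos by simp
    qed
    then have s0: "t0 < s" using s by simp
    have side: "\<bar>x - c\<bar> \<noteq> r"
    proof
      assume "\<bar>x - c\<bar> = r"
      then have "(x - c)\<^sup>2 = r\<^sup>2" by (metis power2_abs)
      then have "xi * (x - c)\<^sup>2 = 4 * ta" using r by (simp add: xi_def)
      then show False using Pub2 Ppos by simp
    qed
    then have xint: "\<bar>x - c\<bar> < r" using x by (auto simp: abs_if split: if_splits)
    have x1: "- 1 < x" "x < 1" "x \<le> b" using x r by auto
    have st: "0 < s" "s < Tm" using s s0 t by auto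
    have "P x s \<le> 4 * ta" using Pub2 xi by (smt (verit) zero_le_mult_iff zero_le_power2)
    then have "g * P x s \<le> gm" using g t mult_left_mono[of "P x s" "4 * ta" g] by (simp add: g_def)
    then have gagm: "ga < gm" using gaP by simp
    have "gm \<le> e / 8" by (simp add: gm_def)
    then have "gm < pi / 2" using e1 pi_gt3 by linarith
    then have "0 < arctan D" using gagm unfolding ga_def by linarith
    then have D: "0 < D" by simp
    \<comment> \<open>The diffusion coefficient: the square of the cosine of the angle
      \<open>arctan D\<close>.\<close>
    define a where "a = 1 / (1 + D\<^sup>2)"
    have pD: "0 < 1 + D\<^sup>2" by (rule add_pos_nonneg) auto
    have a: "0 < a" "a \<le> ga\<^sup>2" "a * D \<le> ga" "a * D\<^sup>2 \<le> 1" "a * (1 + D\<^sup>2) = 1"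
      using arctan_complement_bounds[of D] D pD by (auto simp: a_def ga_def field_simps)
    let ?V1 = "softmin' (v x s)" and ?V2 = "softmin'' (v x s)"
    define Q1 where "Q1 y = ut y s + g * (- v y s + ze * (softmin (v y s) + (1 + y) * (softmin' (v y s) * ux y s))
        - xi * (2 * (y - c)))" for y
    define Q2 where "Q2 = uxt x s + g * (- D + ze * (2 * (?V1 * D)
        + (1 + x) * (?V2 * D\<^sup>2 + ?V1 * ((1 + D\<^sup>2) * ut x s))) - 2 * xi)"
    define Qt where "Qt = a * uxt x s + g * (- (arctan D - pi * x / 2)
        + ze * ((1 + x) * (?V1 * (ut x s - pi / 2))) + kap)"
    have dQ1: "((\<lambda>y. Q y s) has_real_derivative Q1 y) (at y)" if "- 1 < y" "y < 1" for y
    proof -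
      have p: "1 + (ux y s)\<^sup>2 \<noteq> 0" by (metis add_pos_nonneg less_irrefl zero_le_power2 zero_less_one)
      show ?thesis
        unfolding Q_def P_def Q1_def using w_x[OF that st] v_x[OF that st] ux_x[OF that st] p
        by (auto intro!: derivative_eq_intros simp: inverse_eq_divide field_simps)
    qed
    have dQ2: "(Q1 has_real_derivative Q2) (at x)"
      unfolding Q1_def[abs_def] Q2_def
      using w_x[OF x1(1,2) st] v_x[OF x1(1,2) st] ux_x[OF x1(1,2) st] ut_x[OF x1(1,2) st]
      by (auto intro!: derivative_eq_intros simp: D_def power2_eq_square algebra_simps)
    have dQt: "((\<lambda>s. Q x s) has_real_derivative Qt) (at s)"
      unfolding Q_def P_def Qt_def a_def
      using w_t[OF x1(1,2) st] v_t[OF x1(1,2) st] ux_t[OF x1(1,2) st]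
      by (auto intro!: derivative_eq_intros simp: D_def inverse_eq_divide algebra_simps)
    have "Q2 \<le> 0"
    proof (rule max_imp_second_derivative_nonpos)
      show "0 < r - \<bar>x - c\<bar>" using xint by simp
      show "((\<lambda>y. Q y s) has_real_derivative Q1 y) (at y)" if "\<bar>y - x\<bar> < r - \<bar>x - c\<bar>" for y
        by (rule dQ1) (use that r in auto)
      show "(Q1 has_real_derivative Q2) (at x)" by (rule dQ2)
      show "Q y s \<le> Q x s" if "\<bar>y - x\<bar> < r - \<bar>x - c\<bar>" for y
        by (rule max) (use that s in auto)
    qed
    moreover have "0 \<le> Qt"
      by (rule max_imp_time_derivative_nonneg[OF dQt s0]) (use max x s in auto)
    ultimately have ge: "0 \<le> Qt - a * Q2" using mult_nonneg_nonpos[of a Q2] a(1) by simp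
    \<comment> \<open>The terms with \<open>uxt\<close> cancel, and by
      \<open>a * (1 + D\<^sup>2) = 1\<close> so do those with \<open>ut\<close>. Of the time
      derivative of \<open>v\<close> only the drift \<open>- pi / 2\<close> survives.\<close>
    have expand: "Qt - a * Q2 = g * (- (arctan D - pi * x / 2) + kap + a * D + 2 * xi * a
        - ze * ((1 + x) * (?V1 * (pi / 2) + ?V2 * (a * D\<^sup>2)) + 2 * (?V1 * (a * D))))"
    proof -
      have *: "a * (?V1 * ((1 + D\<^sup>2) * ut x s)) = ?V1 * ut x s"
        using a(5) by (metis (no_types, opaque_lifting) mult.left_commute mult.assoc mult_1)
      have "Qt - a * Q2 = g * (- (arctan D - pi * x / 2) + ze * ((1 + x) * (?V1 * (ut x s - pi / 2))) + kap
          - (- (a * D) + ze * (2 * (?V1 * (a * D)) + (1 + x) * (?V2 * (a * D\<^sup>2) + a * (?V1 * ((1 + D\<^sup>2) * ut x s)))) - 2 * xi * a))"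
        unfolding Qt_def Q2_def by (simp add: algebra_simps)
      then show ?thesis unfolding * by (simp add: algebra_simps)
    qed
    have V1: "0 < ?V1" by (rule softmin'_pos)
    have V2: "- ?V1 \<le> ?V2 * (a * D\<^sup>2)"
    proof -
      have "- ?V1 \<le> - (?V1 * (a * D\<^sup>2))" using V1 a(4) by simp
      also have "\<dots> \<le> ?V2 * (a * D\<^sup>2)" 
        using mult_right_mono[OF softmin''_ge, of "a * D\<^sup>2" "v x s"] a(1) by simp
      finally show ?thesis .
    qed
    have "?V1 \<le> ?V1 * (pi / 2)" using V1 pi_gt3 by simp
    then have "0 \<le> (1 + x) * (?V1 * (pi / 2) + ?V2 * (a * D\<^sup>2))"
      using V2 x1 by (intro mult_nonneg_nonneg) auto
    moreover have "0 \<le> ?V1 * (a * D)" using V1 a(1) D by simp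
    ultimately have nn: "0 \<le> ze * ((1 + x) * (?V1 * (pi / 2) + ?V2 * (a * D\<^sup>2)) + 2 * (?V1 * (a * D)))"
      using ze by simp
    \<comment> \<open>The decisive negative term: \<open>- w\<close> falls at rate
      \<open>pi / 2 * (1 - x)\<close> minus the gap, which exceeds \<open>kap\<close> by at least
      \<open>e\<close> minus the gap.\<close>
    have "pi / 2 * (1 - b) \<le> pi / 2 * (1 - x)" using x1 by (intro mult_left_mono) auto
    also have "\<dots> = pi / 2 - pi * x / 2" by (simp add: field_simps)
    finally have th: "kap + e - ga \<le> arctan D - pi * x / 2" using e(2) by (simp add: ga_def)
    have "a \<le> gm\<^sup>2" using a(2) gagm ga0 by (meson less_imp_le order_trans power_mono)
    then have "2 * xi * a \<le> 2 * xi * gm\<^sup>2" using xi by (intro mult_left_mono) auto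
    then have "- (arctan D - pi * x / 2) + kap + a * D + 2 * xi * a
        - ze * ((1 + x) * (?V1 * (pi / 2) + ?V2 * (a * D\<^sup>2)) + 2 * (?V1 * (a * D))) < 0"
      using th nn a(3) gagm gm2 by linarith
    then have "Qt - a * Q2 < 0" unfolding expand using g by (simp add: mult_pos_neg)
    then show False using ge by simp
  qed
  have "Q c (t0 + ta) \<le> 0" using max[of c "t0 + ta"] Qle r t by simp
  then have "arctan (ux c (t0 + ta)) \<le> pi / 2 - g * P c (t0 + ta)" by (simp add: Q_def)
  moreover have "g * Y \<le> g * P c (t0 + ta)"
    by (rule mult_left_mono) (use Y g in \<open>auto simp: P_def\<close>)
  ultimately have "arctan (ux c (t0 + ta)) \<le> pi / 2 - g * Y" by linarith
  then have "ux c (t0 + ta) \<le> 1 / (g * Y)"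
    using Y g by (intro le_inverse_of_arctan_le) simp_all
  also have "\<dots> = 4 * ta / Y * (1 / gm)" using gm t Y by (simp add: g_def field_simps)
  also have "\<dots> \<le> 4 * ta / Y * (8 / e + 4 * sqrt ta / (r * sqrt e))"
  proof (rule mult_left_mono)
    have "1 / gm \<le> max (8 / e) (4 * sqrt ta / (r * sqrt e))"
      unfolding gm_def using e r t by (auto simp: min_def max_def field_simps)
    also have "\<dots> \<le> 8 / e + 4 * sqrt ta / (r * sqrt e)" using e r t by (auto simp: max_def)
    finally show "1 / gm \<le> 8 / e + 4 * sqrt ta / (r * sqrt e)" .
  qed (use Y t in auto)
  finally show ?thesis .
qed

end

section \<open>Slope bounds and their iteration\<close>

context flow_potential
begin

text \<open>Up to sign, the value at \<open>-1\<close> of the tangent line to \<open>w\<close> at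
  \<open>x\<close>. Its derivative in \<open>x\<close> is \<open>(1 + x) * ux x t\<close>, which is
  why slopes carry the weight \<open>1 + x\<close>.\<close>

definition q :: "real \<Rightarrow> real \<Rightarrow> real" where
  "q x t = - w x t + (1 + x) * v x t"

text \<open>The barrier with a radius that keeps the box inside \<open>(-1, b]\<close>. The radius
  shrinks with \<open>1 + c\<close>, and the weight \<open>1 + c\<close> on the slope compensates:
  \<open>(1 + c) / r \<le> 4 / rho\<close>. The number \<open>R\<close> bounds the ratio
  \<open>4 * ta / Y\<close>.\<close>

lemma slope_step:
  fixes b kap e ze c rho t0 ta E Y R :: real
  assumes kap: "0 \<le> kap" "kap \<le> 2" and e: "0 < e" "kap + e \<le> pi / 2 * (1 - b)" and ze: "0 \<le> ze"
    and rho: "0 < rho" "rho \<le> 1" and c: "- 1 < c" "c \<le> b - rho" and b: "b < 1"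
    and t: "0 \<le> t0" "0 < ta" "t0 + ta < Tm"
    and hyp: "\<And>x s. - 1 < x \<Longrightarrow> x \<le> b \<Longrightarrow> t0 \<le> s \<Longrightarrow> s \<le> t0 + ta \<Longrightarrow>
        - w x s + ze * ((1 + x) * softmin (v x s)) \<le> E + 2 * (s - t0)"
    and Y: "0 < Y" "Y \<le> - w c (t0 + ta) + ze * ((1 + c) * softmin (v c (t0 + ta))) - E + kap * ta"
    and R: "4 * ta \<le> R * Y"
  shows "(1 + c) * ux c (t0 + ta) \<le> R * (16 / e + 16 / sqrt e) * (1 + sqrt ta / rho)"
proof -
  define r where "r = min rho (1 + c) / 2"
  have r: "0 < r" "r \<le> rho" "r < 1 + c" "(1 + c) / r \<le> 4 / rho"
  proof -
    show "0 < r" "r \<le> rho" "r < 1 + c" using rho c by (auto simp: r_def min_def)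
    show "(1 + c) / r \<le> 4 / rho"
    proof (cases "rho \<le> 1 + c")
      case True
      have "(1 + c) / r = 2 * (1 + c) / rho" using True by (simp add: r_def)
      also have "\<dots> \<le> 4 / rho" using rho c b by (intro divide_right_mono) auto
      finally show ?thesis .
    next
      case False
      then have "(1 + c) / r = 2" using c by (simp add: r_def field_simps)
      also have "2 \<le> 4 / rho" using rho by (simp add: field_simps)
      finally show ?thesis .
    qed
  qed
  have R0: "0 \<le> 4 * ta / Y" "4 * ta / Y \<le> R" using Y t R by (auto simp: field_simps)
  have "ux c (t0 + ta) \<le> 4 * ta / Y * (8 / e + 4 * sqrt ta / (r * sqrt e))"
    by (rule barrier[OF kap e ze]) (use r rho c b t Y hyp in auto)
  also have "\<dots> \<le> R * (8 / e + 4 * sqrt ta / (r * sqrt e))"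
    using R0 e r t by (intro mult_right_mono) auto
  finally have "(1 + c) * ux c (t0 + ta) \<le> (1 + c) * (R * (8 / e + 4 * sqrt ta / (r * sqrt e)))"
    using c by (intro mult_left_mono) auto
  also have "\<dots> = R * ((1 + c) * (8 / e) + (1 + c) / r * (4 * sqrt ta / sqrt e))"
    by (simp add: algebra_simps)
  also have "\<dots> \<le> R * (2 * (8 / e) + 4 / rho * (4 * sqrt ta / sqrt e))"
    using R0 c b rho e t r by (intro mult_left_mono add_mono mult_right_mono) auto
  also have "\<dots> = R * (16 / e + 16 / sqrt e * (sqrt ta / rho))" by simp
  also have "\<dots> \<le> R * (16 / e * (1 + sqrt ta / rho) + 16 / sqrt e * (1 + sqrt ta / rho))"
    using R0 rho e t by (intro mult_left_mono add_mono) (auto simp: field_simps)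
  also have "\<dots> = R * (16 / e + 16 / sqrt e) * (1 + sqrt ta / rho)" by (simp add: algebra_simps)
  finally show ?thesis .
qed

text \<open>Where \<open>w \<ge> 0\<close> the minimum is at most \<open>0\<close>; elsewhere the
  slice argument bounds \<open>q\<close>. The minimum equals
  \<open>- w x t + (1 + x) * min (v x t) 0\<close>, the quantity that \<open>softmin\<close> smooths
  in the barrier, so the bound can feed the next step.\<close>

lemma min_w_q_le_of_slope_bound:
  assumes t: "0 < t" "t < Tm" and K: "0 \<le> K" and B: "B < 1"
    and slope: "\<And>c. - 1 < c \<Longrightarrow> c \<le> B \<Longrightarrow> w c t \<le> 0 \<Longrightarrow> 0 \<le> q c t \<Longrightarrow> (1 + c) * ux c t \<le> K"
    and x: "- 1 < x" "x \<le> B"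
  shows "min (- w x t) (q x t) \<le> 2 * K"
proof (cases "w x t < 0")
  case True
  have "q x t \<le> 2 * K"
    unfolding q_def
    by (rule slope_bound_of_slice[where w = "\<lambda>y. w y t" and v = "\<lambda>y. v y t" and D = "\<lambda>y. ux y t" and L = "height t"])
      (use t K B x True w_x v_x w_lower slope in \<open>auto simp: q_def\<close>)
  then show ?thesis by simp
next
  case False
  then show ?thesis using K by simp
qed

text \<open>The slice argument needs \<open>w < 0\<close>, while \<open>w\<close> may vanish at
  \<open>0\<close>. If \<open>v > 2 * K\<close> there, then \<open>w < 0\<close> slightly to the
  left, and by continuity still \<open>q > 2 * K\<close>.\<close>

lemma v_le_of_slope_bound:
  assumes t: "0 < t" "t < Tm" and K: "0 \<le> K" and B: "0 \<le> B" "B < 1"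
    and slope: "\<And>c. - 1 < c \<Longrightarrow> c \<le> B \<Longrightarrow> w c t \<le> 0 \<Longrightarrow> 0 \<le> q c t \<Longrightarrow> (1 + c) * ux c t \<le> K"
    and w0: "w 0 t \<le> 0"
  shows "v 0 t \<le> 2 * K"
proof (rule ccontr)
  assume "\<not> ?thesis"
  then have v0: "2 * K < v 0 t" by simp
  have "((\<lambda>y. w y t) has_real_derivative v 0 t) (at 0)" using w_x t by simp
  then obtain d where d: "d > 0" "\<And>h. 0 < h \<Longrightarrow> h < d \<Longrightarrow> w (0 - h) t < w 0 t"
    using DERIV_pos_inc_left[of "\<lambda>y. w y t" "v 0 t" 0] v0 K by auto
  have "((\<lambda>y. q y t) has_real_derivative ux 0 t) (at 0)"
    unfolding q_def[abs_def] using w_x[of 0 t] v_x[of 0 t] t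
    by (auto intro!: derivative_eq_intros)
  then have "isCont (\<lambda>y. q y t) 0" by (rule DERIV_isCont)
  moreover have "2 * K < q 0 t" using v0 w0 by (simp add: q_def)
  ultimately have "\<forall>\<^sub>F y in at 0. 2 * K < q y t"
    unfolding isCont_def by (rule order_tendstoD)
  then obtain d' where d': "d' > 0" "\<And>y. y \<noteq> 0 \<Longrightarrow> \<bar>y\<bar> < d' \<Longrightarrow> 2 * K < q y t"
    by (auto simp: eventually_at dist_real_def)
  define h where "h = min (min d d') 1 / 2"
  have h: "0 < h" "h < d" "h < d'" "h < 1" using d(1) d'(1) by (auto simp: h_def)
  have "min (- w (- h) t) (q (- h) t) \<le> 2 * K"
    by (rule min_w_q_le_of_slope_bound[OF t K B(2) slope]) (use h B in auto)
  moreover have "w (- h) t < 0" using d(2)[of h] h w0 by simp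
  moreover have "2 * K < q (- h) t" using d'(2)[of "- h"] h by simp
  moreover have "q (- h) t \<le> 2 * K"
    unfolding q_def
    by (rule slope_bound_of_slice[where w = "\<lambda>y. w y t" and v = "\<lambda>y. v y t" and D = "\<lambda>y. ux y t" and L = "height t"])
      (use t K B h w_x v_x w_lower slope \<open>w (- h) t < 0\<close> in \<open>auto simp: q_def\<close>)
  ultimately show False by simp
qed

end

section \<open>Quantitative slope bounds on the full time interval and on short windows\<close>

definition step_const :: "real \<Rightarrow> real" where
  "step_const b = 4 / b * (16 / (pi / 2 * b) + 16 / sqrt (pi / 2 * b))"

lemma step_const_ge: 
  assumes "0 < b" "b \<le> 1 / 8"
  shows "1 \<le> step_const b"
proof -
  have pb: "0 < pi / 2 * b" "pi / 2 * b \<le> 1"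
    using assms pi_less_4 mult_mono[of "pi / 2" 2 b "1 / 8"] by auto
  have "1 \<le> 4 / b" "1 \<le> 16 / (pi / 2 * b)" "0 \<le> 16 / sqrt (pi / 2 * b)"
    using assms pb by (auto simp: field_simps)
  moreover from this have "1 \<le> 16 / (pi / 2 * b) + 16 / sqrt (pi / 2 * b)" by linarith
  ultimately have "1 * 1 \<le> 4 / b * (16 / (pi / 2 * b) + 16 / sqrt (pi / 2 * b))"
    using assms by (intro mult_mono) simp_all
  then show ?thesis by (simp add: step_const_def)
qed

context flow_potential
begin

text \<open>The barrier on all of \<open>[0, t]\<close> with \<open>ze = 0\<close>, starting from
  \<open>w_lower\<close>. This is where the waiting time enters: the gain \<open>?k * t\<close>
  exceeds the initial size \<open>A / 2 * (1 + b)\<close> by at least \<open>b * t\<close>.\<close>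

lemma initial_slope:
  assumes b: "0 < b" "b \<le> 1 / 8" and t: "0 < t" "t < Tm" and A: "0 \<le> A" "A \<le> (1 - 8 * b) * (pi * t)"
    and c: "- 1 < c" "c \<le> b / 2" "w c t \<le> 0"
  shows "(1 + c) * ux c t \<le> step_const b * (1 + sqrt t / (b / 2))"
proof -
  let ?k = "pi / 2 * (1 - 2 * b)"
  have "(1 + c) * ux c (0 + t) \<le> 4 / b * (16 / (pi / 2 * b) + 16 / sqrt (pi / 2 * b)) * (1 + sqrt t / (b / 2))"
  proof (rule slope_step[where kap = ?k and E = "A / 2 * (1 + b)" and ze = 0 and Y = "b * t"])
    show "0 \<le> ?k" using b by simp
    have "?k \<le> pi / 2 * 1" using b by (intro mult_left_mono) auto
    then show "?k \<le> 2" using pi_less_4 by linarith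
    show "0 < pi / 2 * b" "?k + pi / 2 * b \<le> pi / 2 * (1 - b)" using b by (auto simp: algebra_simps)
    show "- w x s + 0 * ((1 + x) * softmin (v x s)) \<le> A / 2 * (1 + b) + 2 * (s - 0)"
      if "- 1 < x" "x \<le> b" "0 \<le> s" "s \<le> 0 + t" for x s
    proof -
      have "- w x s \<le> A / 2 * (1 + x) + pi / 2 * (1 + x) * s"
        using w_lower[of x s] that b t by (simp add: height_def algebra_simps)
      also have "\<dots> \<le> A / 2 * (1 + b) + 2 * s"
      proof (rule add_mono)
        show "A / 2 * (1 + x) \<le> A / 2 * (1 + b)" using A that by (intro mult_left_mono) auto
        have "pi / 2 * (1 + x) \<le> 1.6 * 1.125" using pi_approx that b by (intro mult_mono) auto
        then show "pi / 2 * (1 + x) * s \<le> 2 * s" using that by (intro mult_right_mono) auto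
      qed
      finally show ?thesis by simp
    qed
    \<comment> \<open>Since \<open>(1 - 8 * b) * (1 + b) + 5 * b \<le> 1 - 2 * b\<close>, the
      surplus is at least \<open>pi * t / 2 * (5 * b)\<close>, more than
      \<open>b * t\<close>.\<close>
    have "A / 2 * (1 + b) \<le> (1 - 8 * b) * (pi * t) / 2 * (1 + b)"
      using A b by (intro mult_right_mono) auto
    also have "\<dots> = pi * t / 2 * ((1 - 8 * b) * (1 + b))" by simp
    finally have "A / 2 * (1 + b) + pi * t / 2 * (5 * b)
        \<le> pi * t / 2 * ((1 - 8 * b) * (1 + b)) + pi * t / 2 * (5 * b)"
      by (rule add_right_mono)
    also have "\<dots> = pi * t / 2 * ((1 - 8 * b) * (1 + b) + 5 * b)"
      by (rule distrib_left[symmetric])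
    also have "\<dots> \<le> pi * t / 2 * (1 - 2 * b)"
      using t b by (intro mult_left_mono) (auto simp: algebra_simps)
    finally have "A / 2 * (1 + b) + pi * t / 2 * (5 * b) \<le> ?k * t" by (simp add: mult_ac)
    moreover have "b * t * 1 \<le> b * t * (pi / 2 * 5)"
      using b t pi_gt3 by (intro mult_left_mono) auto
    moreover have "b * t * (pi / 2 * 5) = pi * t / 2 * (5 * b)" by simp
    ultimately have "b * t \<le> - w c t - A / 2 * (1 + b) + ?k * t"
      using c by linarith
    then show "b * t \<le> - w c (0 + t) + 0 * ((1 + c) * softmin (v c (0 + t))) - A / 2 * (1 + b) + ?k * t"
      by simp
  qed (use b t c in auto)
  then show ?thesis by (simp add: step_const_def)
qed

text \<open>On the window of length \<open>4 * E\<close> the barrier quantity starts below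
  \<open>E\<close> and ends above \<open>- 2\<close>, while \<open>?k \<ge> 1\<close> contributes
  \<open>4 * E\<close>; so \<open>Y = 2 * E\<close> is available. The slope bound then grows only
  like the square root of \<open>E\<close>.\<close>

lemma iterated_slope:
  assumes b: "0 < b" "b \<le> 1 / 8" and E: "2 \<le> E" and rho: "0 < rho" "rho \<le> 1"
    and B: "B \<le> b" and t: "4 * E \<le> t" "t < Tm"
    and hyp: "\<And>x s. - 1 < x \<Longrightarrow> x \<le> B \<Longrightarrow> t - 4 * E \<le> s \<Longrightarrow> s \<le> t \<Longrightarrow> min (- w x s) (q x s) \<le> E"
    and c: "- 1 < c" "c \<le> B - rho" "w c t \<le> 0" "0 \<le> q c t"
  shows "(1 + c) * ux c t \<le> step_const b * (1 + sqrt (4 * E) / rho)"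
proof -
  let ?k = "pi / 2 * (1 - 2 * b)"
  have "(1 + c) * ux c (t - 4 * E + 4 * E)
      \<le> 4 / b * (16 / (pi / 2 * b) + 16 / sqrt (pi / 2 * b)) * (1 + sqrt (4 * E) / rho)"
  proof (rule slope_step[where kap = ?k and E = E and ze = 1 and Y = "2 * E" and b = B])
    show "0 \<le> ?k" using b by simp
    have "?k \<le> pi / 2 * 1" using b by (intro mult_left_mono) auto
    then show "?k \<le> 2" using pi_less_4 by linarith
    have "?k + pi / 2 * b = pi / 2 * (1 - b)" by (simp add: algebra_simps)
    also have "\<dots> \<le> pi / 2 * (1 - B)" using B by (intro mult_left_mono) auto
    finally show "?k + pi / 2 * b \<le> pi / 2 * (1 - B)" .
    show "0 < pi / 2 * b" using b by simp
    show "- w x s + 1 * ((1 + x) * softmin (v x s)) \<le> E + 2 * (s - (t - 4 * E))"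
      if x: "- 1 < x" "x \<le> B" and s: "t - 4 * E \<le> s" "s \<le> t - 4 * E + 4 * E" for x s
    proof -
      have "(1 + x) * softmin (v x s) \<le> 0" "(1 + x) * softmin (v x s) \<le> (1 + x) * v x s"
        using x softmin_le[of "v x s"] by (auto intro: mult_nonneg_nonpos)
      then have "- w x s + (1 + x) * softmin (v x s) \<le> min (- w x s) (q x s)"
        by (simp add: q_def)
      also have "\<dots> \<le> E" by (rule hyp) (use x s in auto)
      finally show ?thesis using s by simp
    qed
    have "(1 + c) * (min (v c t) 0 - 1) \<le> (1 + c) * softmin (v c t)"
      using c softmin_ge by (intro mult_left_mono) auto
    \<comment> \<open>Apart from the loss of at most \<open>1 + c \<le> 2\<close> due to
      \<open>softmin\<close>, this is \<open>q c t\<close> or \<open>- w c t\<close>, both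
      nonnegative.\<close>
    moreover have "- 2 \<le> - w c t + (1 + c) * (min (v c t) 0 - 1)"
    proof (cases "v c t \<le> 0")
      case True
      then show ?thesis using c rho B b by (simp add: q_def algebra_simps min_def)
    next
      case False
      then show ?thesis using c rho B b by simp
    qed
    moreover have "1 * (4 * E) \<le> ?k * (4 * E)"
    proof (rule mult_right_mono)
      have "3 / 2 * (3 / 4) \<le> pi / 2 * (1 - 2 * b)" using pi_gt3 b by (intro mult_mono) auto
      then show "1 \<le> ?k" by simp
    qed (use E in auto)
    ultimately have "2 * E \<le> - w c t + (1 + c) * softmin (v c t) - E + ?k * (4 * E)"
      using E by linarith
    then show "2 * E \<le> - w c (t - 4 * E + 4 * E) + 1 * ((1 + c) * softmin (v c (t - 4 * E + 4 * E))) - E + ?k * (4 * E)"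
      unfolding mult_1 diff_add_cancel .
    show "4 * (4 * E) \<le> 4 / b * (2 * E)" using b E by (simp add: field_simps)
  qed (use b E rho B t c in auto)
  then show ?thesis by (simp add: step_const_def)
qed

text \<open>The steps go from \<open>j = J\<close> down to \<open>j = 0\<close>. The time windows are proportional to the error
  \<open>16 ^ j * S\<^sup>2\<close>, the losses in \<open>x\<close> to its inverse fourth root; both sum to geometric series, dominated by
  the first and the last step respectively.\<close>

lemma iterate:
  fixes S :: real
  assumes b: "0 < b" "b \<le> 1 / 8" and S: "144 * step_const b / b \<le> S"
    and t: "8 * 16 ^ J * S\<^sup>2 \<le> t" "t < Tm"
    and init: "\<And>x s. - 1 < x \<Longrightarrow> x \<le> b / 2 \<Longrightarrow> t - 8 * 16 ^ J * S\<^sup>2 \<le> s \<Longrightarrow> s \<le> t \<Longrightarrow>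
        min (- w x s) (q x s) \<le> 16 ^ J * S\<^sup>2"
    and j: "j \<le> J"
    and x: "- 1 < x" "x \<le> b / 2 * (1 - (1 / 2) ^ j / 2)" and s: "t - 8 * 16 ^ j * S\<^sup>2 \<le> s" "s \<le> t"
  shows "min (- w x s) (q x s) \<le> 16 ^ j * S\<^sup>2"
  using j x s
proof (induction j arbitrary: x s rule: inc_induct)
  case base
  have "x \<le> b / 2 * (1 - (1 / 2) ^ J / 2)" by fact
  also have "\<dots> \<le> b / 2 * 1" using b by (intro mult_left_mono) auto
  finally show ?case using base by (intro init) auto
next
  case (step j)
  have k1: "1 \<le> step_const b" by (rule step_const_ge[OF b])
  have "144 * 1 \<le> 144 * step_const b / b" using b k1 by (simp add: field_simps)
  then have S1: "144 \<le> S" using S by simp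
  \<comment> \<open>\<open>E\<close> is the error of level \<open>j + 1\<close>, and
    \<open>rho\<close> is exactly the distance between the right ends of levels \<open>j + 1\<close>
    and \<open>j\<close>.\<close>
  define E where "E = 16 ^ Suc j * S\<^sup>2"
  define rho where "rho = b / 4 * (1 / 2) ^ Suc j"
  have E2: "2 \<le> E"
  proof -
    have "1 * 2 \<le> 16 ^ Suc j * S\<^sup>2"
      using S1 one_le_power[of "16::real" "Suc j"] power_mono[of 144 S 2] by (intro mult_mono) auto
    then show ?thesis by (simp add: E_def)
  qed
  \<comment> \<open>Looking back by \<open>4 * E\<close> from the level \<open>j\<close> window of
    length \<open>E / 2\<close> stays inside the level \<open>j + 1\<close> window of length
    \<open>8 * E\<close>.\<close>
  have E': "8 * 16 ^ j * S\<^sup>2 = E / 2" "8 * 16 ^ Suc j * S\<^sup>2 = 8 * E" by (simp_all add: E_def)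
  have sE: "t - E / 2 \<le> s" using step.prems(3) by (simp add: E'(1))
  have s0: "4 * E \<le> s" "s < Tm"
  proof -
    have "(16::real) ^ Suc j \<le> 16 ^ J" using step.hyps by (intro power_increasing) auto
    then have "E \<le> 16 ^ J * S\<^sup>2" unfolding E_def by (intro mult_right_mono) auto
    then have "8 * E \<le> t" using t(1) by linarith
    then show "4 * E \<le> s" using E2 sE by linarith
    show "s < Tm" using step.prems t by simp
  qed
  have rho: "0 < rho" "rho \<le> 1" using b power_le_one[of "1 / 2 :: real" "Suc j"]
     mult_mono[of "b / 4" 1 "(1 / 2) ^ Suc j" "1::real"] by (auto simp: rho_def)
  let ?B = "b / 2 * (1 - (1 / 2) ^ Suc j / 2)"
  have pw: "0 \<le> (1 / 2 :: real) ^ Suc j" by simp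
  have "?B \<le> b / 2 * 1" using b pw by (intro mult_left_mono) linarith+
  then have Bb: "?B \<le> b / 2" by simp
  have "min (- w x s) (q x s) \<le> 2 * (step_const b * (1 + sqrt (4 * E) / rho))"
  proof (rule min_w_q_le_of_slope_bound[where B = "?B - rho"])
    show "(1 + c) * ux c s \<le> step_const b * (1 + sqrt (4 * E) / rho)"
      if c: "- 1 < c" "c \<le> ?B - rho" "w c s \<le> 0" "0 \<le> q c s" for c
    proof (rule iterated_slope[OF b E2 rho _ s0 _ c])
      show "?B \<le> b" using Bb b by linarith
      show "min (- w x' s') (q x' s') \<le> E"
        if "- 1 < x'" "x' \<le> ?B" "s - 4 * E \<le> s'" "s' \<le> s" for x' s'
      proof -
        have "t - 8 * 16 ^ Suc j * S\<^sup>2 \<le> s'"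
          unfolding E'(2) using that sE E2 by linarith
        then show ?thesis unfolding E_def using that step.prems by (intro step.IH) auto
      qed
    qed
    show "?B - rho < 1" using Bb b rho by linarith
    show "x \<le> ?B - rho" using step.prems(2) by (simp add: rho_def algebra_simps)
    show "0 \<le> step_const b * (1 + sqrt (4 * E) / rho)" using k1 rho E2 by simp
  qed (use s0 E2 step.prems in auto)
  \<comment> \<open>The new bound is of order \<open>8 ^ j * S\<close>. It is absorbed by
    \<open>16 ^ j * S\<^sup>2\<close> because \<open>S\<close> is at least
    \<open>144 * step_const b / b\<close>.\<close>
  also have "\<dots> \<le> 16 ^ j * S\<^sup>2"
  proof -
    have "sqrt (4 * E) = 2 * (4 ^ Suc j * S)"
    proof (rule real_sqrt_unique)
      have "(4 ^ Suc j)\<^sup>2 = (16::real) ^ Suc j" by (simp add: power2_eq_square flip: power_mult_distrib)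
      then show "(2 * (4 ^ Suc j * S))\<^sup>2 = 4 * E" by (simp add: E_def power_mult_distrib)
    qed (use S1 in auto)
    moreover have p8: "2 ^ j * 4 ^ j = (8::real) ^ j" by (simp flip: power_mult_distrib)
    ultimately have "sqrt (4 * E) / rho = 2 * (4 ^ Suc j * S) * (4 / b * 2 ^ Suc j)"
      using b by (simp add: rho_def power_one_over)
    also have "\<dots> = 64 * (8 ^ j * S / b)"
      using p8 by (simp add: mult_ac)
    finally have sq: "sqrt (4 * E) / rho = 64 * (8 ^ j * S / b)" .
    have "1 * 1 \<le> 8 ^ j * (S / b)" using b S1 by (intro mult_mono) (auto simp: field_simps)
    moreover have "8 ^ j * (S / b) = 8 ^ j * S / b" by simp
    ultimately have "1 + sqrt (4 * E) / rho \<le> 72 * (8 ^ j * S / b)" unfolding sq by linarith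
    then have "2 * (step_const b * (1 + sqrt (4 * E) / rho)) \<le> 2 * (step_const b * (72 * (8 ^ j * S / b)))"
      using k1 by (intro mult_left_mono) auto
    also have "\<dots> = 144 * step_const b / b * (8 ^ j * S)" by simp
    also have "\<dots> \<le> S * (16 ^ j * S)"
      using S S1 k1 b by (intro mult_mono) (auto intro: power_mono)
    finally show ?thesis by (simp add: power2_eq_square mult_ac)
  qed
  finally show ?case .
qed

text \<open>For bounded \<open>t\<close> the initial slope bound suffices. For large
  \<open>t\<close> its error \<open>E0\<close>, of order \<open>sqrt t\<close>, starts the
  iteration, which brings it down to the constant \<open>S\<^sup>2\<close>; one last short window
  then bounds \<open>v\<close> at \<open>0\<close>.\<close>

lemma v_center_le:
  assumes b: "0 < b" "b < 1 / 8" and t: "0 < t" "t < Tm" and A: "0 \<le> A" "A \<le> (1 - 8 * b)\<^sup>2 * (pi * t)"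
    and w0: "w 0 t \<le> 0"
  shows "v 0 t \<le> 2 * step_const b * (1 + 1152 * step_const b / b ^ 3)"
proof -
  define K where "K = step_const b"
  have K: "1 \<le> K" unfolding K_def by (rule step_const_ge) (use b in auto)
  have init: "min (- w x s) (q x s) \<le> 2 * (K * (1 + sqrt s / (b / 2)))"
    and init_slope: "w x s \<le> 0 \<Longrightarrow> (1 + x) * ux x s \<le> K * (1 + sqrt s / (b / 2))"
    if x: "- 1 < x" "x \<le> b / 2" and s: "(1 - 8 * b) * t \<le> s" "s \<le> t" for x s
  proof -
    have "0 < (1 - 8 * b) * t" using b t by simp
    then have s0: "0 < s" "s < Tm" using s t by auto
    \<comment> \<open>One factor \<open>1 - 8 * b\<close> is spent on going back to time
      \<open>s\<close>, the other remains as the hypothesis of the initial slope bound.\<close>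
    have "(1 - 8 * b)\<^sup>2 * (pi * t) = (1 - 8 * b) * (pi * ((1 - 8 * b) * t))"
      by (simp add: power2_eq_square)
    also have "\<dots> \<le> (1 - 8 * b) * (pi * s)" using s b by (intro mult_left_mono) auto
    finally have As: "A \<le> (1 - 8 * b) * (pi * s)" using A by linarith
    have slope: "(1 + c) * ux c s \<le> K * (1 + sqrt s / (b / 2))"
      if "- 1 < c" "c \<le> b / 2" "w c s \<le> 0" for c
      unfolding K_def by (rule initial_slope) (use b s0 A As that in auto)
    show "min (- w x s) (q x s) \<le> 2 * (K * (1 + sqrt s / (b / 2)))"
      by (rule min_w_q_le_of_slope_bound[where B = "b / 2"]) (use s0 K b x slope in auto)
    show "(1 + x) * ux x s \<le> K * (1 + sqrt s / (b / 2))" if "w x s \<le> 0"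
      by (rule slope) (use x that in auto)
  qed
  have b3: "b ^ 3 \<le> b\<^sup>2" using b by (intro power_decreasing) auto
  have tb: "(1 - 8 * b) * t \<le> t" using b t by simp
  show ?thesis
  proof (cases "sqrt t \<le> 144 * K / b\<^sup>2")
    case True
    have "v 0 t \<le> 2 * (K * (1 + sqrt t / (b / 2)))"
      by (rule v_le_of_slope_bound[where B = "b / 2"]) (use t K b w0 init_slope tb in auto)
    also have "\<dots> = 2 * K * (1 + 2 / b * sqrt t)" by simp
    also have "\<dots> \<le> 2 * K * (1 + 2 / b * (144 * K / b\<^sup>2))"
      using True K b by (intro mult_left_mono add_left_mono) auto
    also have "\<dots> = 2 * K * (1 + 288 * K / b ^ 3)" by (simp add: power2_eq_square power3_eq_cube)
    also have "\<dots> \<le> 2 * K * (1 + 1152 * K / b ^ 3)"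
      using K b by (intro mult_left_mono add_left_mono divide_right_mono) auto
    finally show ?thesis by (simp add: K_def)
  next
    case False
    define S where "S = 144 * K / b"
    have S: "144 \<le> S" using K b by (simp add: S_def field_simps)
    have Sb: "S / b \<le> sqrt t" using False by (simp add: S_def power2_eq_square)
    have tt: "sqrt t * sqrt t = t" using t by simp
    define E0 where "E0 = 2 * (K * (1 + sqrt t / (b / 2)))"
    have St: "S\<^sup>2 \<le> b * t"
    proof -
      have "S * S \<le> (b * sqrt t) * sqrt t"
      proof (rule mult_mono)
        show "S \<le> b * sqrt t" using Sb b by (simp add: field_simps)
        have "S * 1 \<le> S * (1 / b)" using S b by (intro mult_left_mono) auto
        then show "S \<le> sqrt t" using Sb by simp
      qed (use S b t in auto)
      then show ?thesis using tt by (simp add: power2_eq_square mult.assoc)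
    qed
    have Et: "16 * E0 \<le> b * t"
    proof -
      have s1: "1 \<le> sqrt t / b"
      proof -
        have "b * b \<le> 1 * 1" using b by (intro mult_mono) auto
        then have "b \<le> S / b" using S b by (simp add: field_simps)
        then have "b \<le> sqrt t" using Sb by linarith
        then show ?thesis using b by simp
      qed
      have "16 * E0 = 32 * K * (1 + 2 * (sqrt t / b))" by (simp add: E0_def)
      also have "\<dots> \<le> 32 * K * (3 * (sqrt t / b))" using K s1 by (intro mult_left_mono) auto
      also have "\<dots> = (96 * K / b\<^sup>2) * (b * sqrt t)" using b by (simp add: power2_eq_square)
      also have "\<dots> \<le> sqrt t * (b * sqrt t)"
      proof (rule mult_right_mono)
        have "96 * K / b\<^sup>2 \<le> 144 * K / b\<^sup>2" using K by (intro divide_right_mono) auto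
        then show "96 * K / b\<^sup>2 \<le> sqrt t" using False by simp
      qed (use b t in auto)
      finally show ?thesis using tt by (simp add: mult.left_commute)
    qed
    have ex: "\<exists>n. E0 \<le> 16 ^ n * S\<^sup>2"
    proof -
      obtain n where "E0 < (16::real) ^ n" using real_arch_pow[of 16 E0] by auto
      also have "(16::real) ^ n * 1 \<le> 16 ^ n * S\<^sup>2"
        using S one_le_power[of S 2] by (intro mult_left_mono) auto
      finally show ?thesis by (intro exI[of _ n]) simp
    qed
    \<comment> \<open>The least starting level that covers \<open>E0\<close>. Minimality, with
      \<open>16 * E0 \<le> b * t\<close>, keeps its whole time window within the last
      \<open>8 * b * t\<close>, where \<open>init\<close> applies.\<close>
    define J where "J = (LEAST n. E0 \<le> 16 ^ n * S\<^sup>2)"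
    have J: "E0 \<le> 16 ^ J * S\<^sup>2" unfolding J_def using ex by (rule LeastI_ex)
    have Jt: "16 ^ J * S\<^sup>2 \<le> b * t"
    proof (cases J)
      case 0
      then show ?thesis using St by simp
    next
      case (Suc n)
      have "\<not> E0 \<le> 16 ^ n * S\<^sup>2" using not_less_Least[of n "\<lambda>n. E0 \<le> 16 ^ n * S\<^sup>2"] Suc by (simp add: J_def)
      then show ?thesis using Et by (simp add: Suc)
    qed
    have bt: "8 * (b * t) \<le> t" using b t by simp
    have tJ: "8 * 16 ^ J * S\<^sup>2 \<le> t" using Jt bt by simp
    have H: "min (- w x s) (q x s) \<le> S\<^sup>2"
      if x: "- 1 < x" "x \<le> b / 4" and s: "t - 8 * S\<^sup>2 \<le> s" "s \<le> t" for x s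
    proof -
      have "min (- w x s) (q x s) \<le> 16 ^ 0 * S\<^sup>2"
      proof (rule iterate[OF _ _ _ tJ])
        show "min (- w x s) (q x s) \<le> 16 ^ J * S\<^sup>2"
          if x: "- 1 < x" "x \<le> b / 2" and s: "t - 8 * 16 ^ J * S\<^sup>2 \<le> s" "s \<le> t" for x s
        proof -
          have "(1 - 8 * b) * t \<le> s" using s Jt by (simp add: algebra_simps)
          then have "min (- w x s) (q x s) \<le> 2 * (K * (1 + sqrt s / (b / 2)))"
            using x s by (intro init) auto
          also have "\<dots> \<le> E0" unfolding E0_def
            using K b s by (intro mult_left_mono add_left_mono divide_right_mono) auto
          finally show ?thesis using J by simp
        qed
      qed (use b t x s in \<open>auto simp: S_def K_def\<close>)
      then show ?thesis by simp
    qed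
    \<comment> \<open>Level \<open>0\<close> ends at \<open>b / 4\<close>, so with
      \<open>rho = b / 4\<close> the slope bound reaches exactly to \<open>x = 0\<close>.\<close>
    have "v 0 t \<le> 2 * (K * (1 + sqrt (4 * S\<^sup>2) / (b / 4)))"
    proof (rule v_le_of_slope_bound[where B = 0])
      show "(1 + c) * ux c t \<le> K * (1 + sqrt (4 * S\<^sup>2) / (b / 4))"
        if "- 1 < c" "c \<le> 0" "w c t \<le> 0" "0 \<le> q c t" for c
        unfolding K_def
      proof (rule iterated_slope[where B = "b / 4"])
        show "2 \<le> S\<^sup>2" using S power_mono[of 144 S 2] by simp
        have "1 * S\<^sup>2 \<le> 16 ^ J * S\<^sup>2" by (intro mult_right_mono) auto
        then show "4 * S\<^sup>2 \<le> t" using Jt bt t by linarith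
        show "min (- w x s) (q x s) \<le> S\<^sup>2"
          if "- 1 < x" "x \<le> b / 4" "t - 4 * S\<^sup>2 \<le> s" "s \<le> t" for x s
          by (rule H) (use that zero_le_power2[of S] in linarith)+
      qed (use b t that in auto)
    qed (use t K b w0 in auto)
    also have "sqrt (4 * S\<^sup>2) / (b / 4) = 1152 * K / b\<^sup>2"
    proof -
      have "sqrt (4 * S\<^sup>2) = 2 * S" using S by (simp add: real_sqrt_mult)
      then show ?thesis using b by (simp add: S_def power2_eq_square)
    qed
    also have "2 * (K * (1 + 1152 * K / b\<^sup>2)) \<le> 2 * (K * (1 + 1152 * K / b ^ 3))"
      using K b b3 by (intro mult_left_mono add_left_mono divide_left_mono) auto
    finally show ?thesis by (simp add: K_def)
  qed
qed

end


section \<open>Symmetries: reflection in space and change of sign\<close>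

lemma flow_potential_reflect:
  assumes "flow_potential Tm A ph u ux ut uxt"
  shows "flow_potential Tm A (\<lambda>x t. - ph (- x) t) (\<lambda>x t. u (- x) t) (\<lambda>x t. - ux (- x) t)
    (\<lambda>x t. ut (- x) t) (\<lambda>x t. - uxt (- x) t)"
proof -
  interpret flow_potential Tm A ph u ux ut uxt by fact
  have c: "continuous_on ({- 1<..<1} \<times> {0..<Tm}) (\<lambda>p. f (- fst p) (snd p))"
    if "continuous_on ({- 1<..<1} \<times> {0..<Tm}) (\<lambda>p. f (fst p) (snd p))" for f :: "real \<Rightarrow> real \<Rightarrow> real"
  proof -
    have "continuous_on ({- 1<..<1} \<times> {0..<Tm}) (\<lambda>p. (- fst p :: real, snd p))"
      by (intro continuous_intros)
    moreover have "(\<lambda>p. (- fst p :: real, snd p)) ` ({- 1<..<1} \<times> {0..<Tm}) \<subseteq> {- 1<..<1} \<times> {0..<Tm}"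
      by auto
    ultimately show ?thesis using continuous_on_compose2[OF that] by fastforce
  qed
  have mirror: "((\<lambda>y. f (- y)) has_real_derivative - D) (at x)"
    if "(f has_real_derivative D) (at (- x))" for f :: "real \<Rightarrow> real" and D x
    using that by (simp add: DERIV_mirror)
  show ?thesis
  proof
    fix x t :: real
    assume xt: "- 1 < x" "x < 1" "0 < t" "t < Tm"
    then have x: "- 1 < - x" "- x < 1" by auto
    show "((\<lambda>y. - ph (- y) t) has_real_derivative u (- x) t) (at x)"
      using DERIV_minus[OF mirror[OF ph_x[OF x xt(3,4)]]] by simp
    show "((\<lambda>y. u (- y) t) has_real_derivative - ux (- x) t) (at x)"
      by (rule mirror[OF u_x[OF x xt(3,4)]])
    show "((\<lambda>y. ut (- y) t) has_real_derivative - uxt (- x) t) (at x)"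
      by (rule mirror[OF ut_x[OF x xt(3,4)]])
    show "((\<lambda>y. - ux (- y) t) has_real_derivative (1 + (- ux (- x) t)\<^sup>2) * ut (- x) t) (at x)"
      using DERIV_minus[OF mirror[OF ux_x[OF x xt(3,4)]]] by simp
    show "((\<lambda>s. - ph (- x) s) has_real_derivative arctan (- ux (- x) t)) (at t)"
      using DERIV_minus[OF ph_t[OF x xt(3,4)]] by (simp add: arctan_minus)
    show "((\<lambda>s. u (- x) s) has_real_derivative ut (- x) t) (at t)"
      using u_t[OF x xt(3,4)] .
    show "((\<lambda>s. - ux (- x) s) has_real_derivative - uxt (- x) t) (at t)"
      by (rule DERIV_minus[OF ux_t[OF x xt(3,4)]])
  next
    show "\<bar>- ph (- x) t\<bar> \<le> A / 2 + pi * t / 2" if "- 1 < x" "x < 1" "0 \<le> t" "t < Tm" for x t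
      using ph_bound[of "- x" t] that by simp
  qed (intro continuous_intros c cont)+
qed

text \<open>Turns the upper bound at the centre into a lower bound; the equation is preserved
  because \<open>arctan\<close> is odd.\<close>

lemma flow_potential_uminus:
  assumes "flow_potential Tm A ph u ux ut uxt"
  shows "flow_potential Tm A (\<lambda>x t. - ph x t) (\<lambda>x t. - u x t) (\<lambda>x t. - ux x t)
    (\<lambda>x t. - ut x t) (\<lambda>x t. - uxt x t)"
proof -
  interpret flow_potential Tm A ph u ux ut uxt by fact
  show ?thesis
  proof
    fix x t :: real
    assume xt: "- 1 < x" "x < 1" "0 < t" "t < Tm"
    show "((\<lambda>y. - ph y t) has_real_derivative - u x t) (at x)" by (rule DERIV_minus[OF ph_x[OF xt]])
    show "((\<lambda>s. - ph x s) has_real_derivative arctan (- ux x t)) (at t)"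
      using DERIV_minus[OF ph_t[OF xt]] by (simp add: arctan_minus)
    show "((\<lambda>y. - u y t) has_real_derivative - ux x t) (at x)" by (rule DERIV_minus[OF u_x[OF xt]])
    show "((\<lambda>s. - u x s) has_real_derivative - ut x t) (at t)" by (rule DERIV_minus[OF u_t[OF xt]])
    show "((\<lambda>y. - ux y t) has_real_derivative (1 + (- ux x t)\<^sup>2) * - ut x t) (at x)"
      using DERIV_minus[OF ux_x[OF xt]] by simp
    show "((\<lambda>s. - ux x s) has_real_derivative - uxt x t) (at t)" by (rule DERIV_minus[OF ux_t[OF xt]])
    show "((\<lambda>y. - ut y t) has_real_derivative - uxt x t) (at x)" by (rule DERIV_minus[OF ut_x[OF xt]])
  qed (use ph_bound in \<open>auto intro!: continuous_intros cont\<close>)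
qed

definition center_const :: "real \<Rightarrow> real" where
  "center_const b = 2 * step_const b * (1 + 1152 * step_const b / b ^ 3)"

text \<open>If \<open>w 0 t \<ge> 0\<close>, the reflected flow has \<open>w 0 t \<le> 0\<close> and the same \<open>v 0 t\<close>.\<close>

lemma u_center_le:
  assumes F: "flow_potential Tm A ph u ux ut uxt"
    and *: "0 < b" "b < 1 / 8" "0 < t" "t < Tm" "0 \<le> A" "A \<le> (1 - 8 * b)\<^sup>2 * (pi * t)"
  shows "u 0 t \<le> center_const b + A / 2 + pi * t / 2"
proof -
  note defs = flow_potential.w_def flow_potential.v_def flow_potential.height_def
  note G = flow_potential_reflect[OF F]
  consider "ph 0 t \<le> 0" | "- ph 0 t \<le> 0" by linarith
  then show ?thesis
  proof cases
    case 1
    then show ?thesis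
      using flow_potential.v_center_le[OF F *] by (simp add: defs[OF F] center_const_def)
  next
    case 2
    then show ?thesis
      using flow_potential.v_center_le[OF G *] by (simp add: defs[OF G] center_const_def)
  qed
qed

lemma abs_u_center_le:
  assumes "flow_potential Tm A ph u ux ut uxt"
    and "0 < b" "b < 1 / 8" "0 < t" "t < Tm" "0 \<le> A" "A \<le> (1 - 8 * b)\<^sup>2 * (pi * t)"
  shows "\<bar>u 0 t\<bar> \<le> center_const b + A / 2 + pi * t / 2"
  using u_center_le[OF assms] u_center_le[OF flow_potential_uminus[OF assms(1)] assms(2-)] by linarith

section \<open>The potential of a flow\<close>

lemma has_derivative_slice_x:
  fixes f :: "real \<times> real \<Rightarrow> real"
  assumes f: "(f has_derivative f') (at (x, t) within {- 1<..<1} \<times> {0..<Tm})"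
    and x: "- 1 < x" "x < 1" and t: "0 \<le> t" "t < Tm"
  shows "((\<lambda>y. f (y, t)) has_real_derivative f' (1, 0)) (at x)"
proof -
  interpret bounded_linear f' using f by (rule has_derivative_bounded_linear)
  have "((\<lambda>y. (y, t)) has_derivative (\<lambda>h. (h, 0))) (at x within {- 1<..<1})"
    by (auto intro!: derivative_eq_intros)
  moreover have "(f has_derivative f') (at (x, t) within (\<lambda>y. (y, t)) ` {- 1<..<1})"
    by (rule has_derivative_subset[OF f]) (use t in auto)
  ultimately have "((\<lambda>y. f (y, t)) has_derivative (\<lambda>h. f' (h, 0))) (at x within {- 1<..<1})"
    by (rule has_derivative_in_compose)
  moreover have "(\<lambda>h. f' (h, 0)) = (*) (f' (1, 0))"
  proof
    show "f' (h, 0) = f' (1, 0) * h" for h using scaleR[of h "(1, 0)"] by simp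
  qed
  ultimately have "((\<lambda>y. f (y, t)) has_real_derivative f' (1, 0)) (at x within {- 1<..<1})"
    unfolding has_field_derivative_def by (simp only:)
  then show ?thesis using x by (simp add: at_within_open[of x "{- 1<..<1}"])
qed

lemma has_derivative_slice_t:
  fixes f :: "real \<times> real \<Rightarrow> real"
  assumes f: "(f has_derivative f') (at (x, t) within {- 1<..<1} \<times> {0..<Tm})"
    and x: "- 1 < x" "x < 1" and t: "0 < t" "t < Tm"
  shows "((\<lambda>s. f (x, s)) has_real_derivative f' (0, 1)) (at t)"
proof -
  interpret bounded_linear f' using f by (rule has_derivative_bounded_linear)
  have "((\<lambda>s. (x, s)) has_derivative (\<lambda>h. (0, h))) (at t within {0<..<Tm})"
    by (auto intro!: derivative_eq_intros)
  moreover have "(f has_derivative f') (at (x, t) within (\<lambda>s. (x, s)) ` {0<..<Tm})"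
    by (rule has_derivative_subset[OF f]) (use x in auto)
  ultimately have "((\<lambda>s. f (x, s)) has_derivative (\<lambda>h. f' (0, h))) (at t within {0<..<Tm})"
    by (rule has_derivative_in_compose)
  moreover have "(\<lambda>h. f' (0, h)) = (*) (f' (0, 1))"
  proof
    show "f' (0, h) = f' (0, 1) * h" for h using scaleR[of h "(0, 1)"] by simp
  qed
  ultimately have "((\<lambda>s. f (x, s)) has_real_derivative f' (0, 1)) (at t within {0<..<Tm})"
    unfolding has_field_derivative_def by (simp only:)
  then show ?thesis using t by (simp add: at_within_open[of t "{0<..<Tm}"])
qed

lemma continuous_on_slices:
  fixes f :: "real \<times> real \<Rightarrow> real"
  assumes f: "continuous_on ({- 1<..<1} \<times> {0..<Tm}) f"
  shows "- 1 < x \<Longrightarrow> x < 1 \<Longrightarrow> t < Tm \<Longrightarrow> continuous_on {0..t} (\<lambda>s. f (x, s))"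
  by (rule continuous_on_compose2[OF f]) (auto intro!: continuous_intros)

lemma integral_x_derivative:
  fixes f g :: "real \<times> real \<Rightarrow> real"
  assumes f: "continuous_on ({- 1<..<1} \<times> {0..<Tm}) f" and g: "continuous_on ({- 1<..<1} \<times> {0..<Tm}) g"
    and d: "\<And>x s. - 1 < x \<Longrightarrow> x < 1 \<Longrightarrow> 0 \<le> s \<Longrightarrow> s < Tm \<Longrightarrow> ((\<lambda>y. f (y, s)) has_real_derivative g (x, s)) (at x)"
    and x: "- 1 < x" "x < 1" and t: "t < Tm"
  shows "((\<lambda>y. integral {0..t} (\<lambda>s. f (y, s))) has_real_derivative integral {0..t} (\<lambda>s. g (x, s))) (at x)"
proof -
  have "((\<lambda>y. integral (cbox 0 t) ((\<lambda>y s. f (y, s)) y)) has_real_derivative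
      integral (cbox 0 t) ((\<lambda>x s. g (x, s)) x)) (at x within {- 1<..<1})"
  proof (rule leibniz_rule_field_derivative)
    show "((\<lambda>y. f (y, s)) has_real_derivative g (y, s)) (at y within {- 1<..<1})"
      if "y \<in> {- 1<..<1}" "s \<in> cbox 0 t" for y s
      using d[of y s] that t by (auto intro: has_field_derivative_at_within)
    show "(\<lambda>s. f (y, s)) integrable_on cbox 0 t" if "y \<in> {- 1<..<1}" for y
      using continuous_on_slices[OF f, of y t] that t by (auto intro!: integrable_continuous_real)
    have "continuous_on ({- 1<..<1} \<times> cbox 0 t) g"
      by (rule continuous_on_subset[OF g]) (use t in auto)
    then show "continuous_on ({- 1<..<1} \<times> cbox 0 t) (\<lambda>(x, s). g (x, s))"
      by (simp add: case_prod_beta)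
  qed (use x in auto)
  then show ?thesis using x by (simp add: at_within_open[of x "{- 1<..<1}"] cbox_interval)
qed

lemma integral_t_derivative:
  fixes f :: "real \<times> real \<Rightarrow> real"
  assumes f: "continuous_on ({- 1<..<1} \<times> {0..<Tm}) f"
    and x: "- 1 < x" "x < 1" and t: "0 < t" "t < Tm"
  shows "((\<lambda>t. integral {0..t} (\<lambda>s. f (x, s))) has_real_derivative f (x, t)) (at t)"
proof -
  define t' where "t' = (t + Tm) / 2"
  have t': "t < t'" "t' < Tm" using t by (auto simp: t'_def)
  have "((\<lambda>t. integral {0..t} (\<lambda>s. f (x, s))) has_real_derivative f (x, t)) (at t within {0..t'})"
    by (rule integral_has_real_derivative) (use continuous_on_slices[OF f x t'(2)] t t' in auto)
  moreover have "at t within {0..t'} = at t"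
    by (rule at_within_interior) (use t t' in auto)
  ultimately show ?thesis by simp
qed

lemma integral_of_t_derivative:
  fixes f g :: "real \<times> real \<Rightarrow> real"
  assumes f: "continuous_on ({- 1<..<1} \<times> {0..<Tm}) f"
    and d: "\<And>s. 0 < s \<Longrightarrow> s < Tm \<Longrightarrow> ((\<lambda>s. f (x, s)) has_real_derivative g (x, s)) (at s)"
    and x: "- 1 < x" "x < 1" and t: "0 \<le> t" "t < Tm"
  shows "integral {0..t} (\<lambda>s. g (x, s)) = f (x, t) - f (x, 0)"
proof (rule integral_unique, rule fundamental_theorem_of_calculus_interior)
  show "continuous_on {0..t} (\<lambda>s. f (x, s))" by (rule continuous_on_slices[OF f x t(2)])
  show "((\<lambda>s. f (x, s)) has_vector_derivative g (x, s)) (at s)" if "s \<in> {0<..<t}" for s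
    using d[of s] that t by (simp add: has_real_derivative_iff_has_vector_derivative)
qed (use t in auto)

text \<open>\<open>P\<close> is the mean of the primitives vanishing at the left and at the right
  end. Its absolute value is thus at most half of the total integral of
  \<open>\<bar>f\<bar>\<close>, which gives \<open>A / 2\<close> instead of
  \<open>A\<close>.\<close>

lemma L1_primitive:
  fixes f :: "real \<Rightarrow> real"
  assumes int: "set_integrable lborel {- 1<..<1} f" and cont: "continuous_on {- 1<..<1} f"
  obtains P where "\<And>x. - 1 < x \<Longrightarrow> x < 1 \<Longrightarrow> (P has_real_derivative f x) (at x)"
    and "\<And>x. - 1 < x \<Longrightarrow> x < 1 \<Longrightarrow> \<bar>P x\<bar> \<le> L1_norm_on {- 1<..<1} f / 2"
proof
  define h where "h x = indicator {- 1<..<1} x * f x" for x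
  define P where "P x = (integral {- 1..x} h - integral {x..1} h) / 2" for x
  have h: "integrable lborel h" using int by (simp add: set_integrable_def h_def[abs_def])
  have "integrable lborel (\<lambda>x. \<bar>h x\<bar>)" using h by simp
  then have ha: "(\<lambda>x. \<bar>h x\<bar>) integrable_on UNIV" "integral UNIV (\<lambda>x. \<bar>h x\<bar>) = (\<integral>x. \<bar>h x\<bar> \<partial>lborel)"
    by (auto intro: integrable_on_lborel integral_lborel)
  have L: "L1_norm_on {- 1<..<1} f = integral UNIV (\<lambda>x. \<bar>h x\<bar>)"
    unfolding ha(2) unfolding L1_norm_on_def set_lebesgue_integral_def h_def by (simp add: abs_mult)
  have hi: "h integrable_on {a..b}" "(\<lambda>x. \<bar>h x\<bar>) integrable_on {a..b}" for a b
    using integrable_on_subinterval[OF integrable_on_lborel[OF h]] integrable_on_subinterval[OF ha(1)] by auto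
  have split: "integral {a..c} h = integral {a..b} h + integral {b..c} h" if "a \<le> b" "b \<le> c" for a b c
    using Henstock_Kurzweil_Integration.integral_combine[OF that hi(1)] by simp
  show "\<bar>P x\<bar> \<le> L1_norm_on {- 1<..<1} f / 2" if x: "- 1 < x" "x < 1" for x
  proof -
    have bd: "\<bar>integral {a..b} h\<bar> \<le> integral {a..b} (\<lambda>x. \<bar>h x\<bar>)" for a b
      using integral_norm_bound_integral[OF hi, of a b] by auto
    have "integral {- 1..x} (\<lambda>x. \<bar>h x\<bar>) + integral {x..1} (\<lambda>x. \<bar>h x\<bar>) = integral {- 1..1} (\<lambda>x. \<bar>h x\<bar>)"
      by (rule Henstock_Kurzweil_Integration.integral_combine) (use x hi in auto)
    also have "\<dots> \<le> L1_norm_on {- 1<..<1} f"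
      unfolding L by (rule integral_subset_le) (use hi ha in auto)
    finally show ?thesis using bd[of "- 1" x] bd[of x 1] by (auto simp: P_def)
  qed
  show "(P has_real_derivative f x) (at x)" if x: "- 1 < x" "x < 1" for x
  proof -
    \<comment> \<open>\<open>h\<close> need not be continuous at the ends, so the derivative is
      taken on a compact interval inside, where \<open>P\<close> differs from a primitive of
      \<open>h\<close> by a constant.\<close>
    define a b where "a = (x - 1) / 2" and "b = (x + 1) / 2"
    have ab: "- 1 < a" "a < x" "x < b" "b < 1" using x by (auto simp: a_def b_def)
    have "continuous_on {a..b} h"
      by (rule continuous_on_eq[OF continuous_on_subset[OF cont]]) (use ab in \<open>auto simp: h_def\<close>)
    then have "((\<lambda>y. integral {a..y} h) has_real_derivative h x) (at x within {a..b})"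
      by (rule integral_has_real_derivative) (use ab in auto)
    then have D: "((\<lambda>y. integral {a..y} h + (integral {- 1..a} h - integral {a..1} h) / 2) has_real_derivative h x)
        (at x within {a..b})"
      by (auto intro!: derivative_eq_intros)
    have eq: "integral {a..y} h + (integral {- 1..a} h - integral {a..1} h) / 2 = P y" if "y \<in> {a..b}" for y
      using that ab split[of "- 1" a y] split[of a y 1] by (simp add: P_def field_simps)
    have "(P has_real_derivative h x) (at x within {a..b})"
      by (rule has_field_derivative_transform_within[OF D, where d = 1]) (use ab eq in auto)
    moreover have "at x within {a..b} = at x" by (rule at_within_interior) (use ab in auto)
    ultimately show ?thesis using x by (simp add: h_def)
  qed
qed

text \<open>Moving first to the fixed time \<open>t\<close> costs at most
  \<open>L * \<bar>s - t\<bar>\<close> uniformly in \<open>x\<close>; the rest is continuity of one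
  slice. For the potential, \<open>L = pi / 2\<close>.\<close>

lemma continuous_on_uniform_lipschitz_snd:
  fixes f :: "real \<times> real \<Rightarrow> real"
  assumes L: "\<And>x s t. x \<in> X \<Longrightarrow> s \<in> I \<Longrightarrow> t \<in> I \<Longrightarrow> \<bar>f (x, s) - f (x, t)\<bar> \<le> L * \<bar>s - t\<bar>"
    and c: "\<And>t. t \<in> I \<Longrightarrow> continuous_on X (\<lambda>x. f (x, t))"
  shows "continuous_on (X \<times> I) f"
  unfolding continuous_on_def
proof
  fix p assume p: "p \<in> X \<times> I"
  obtain x t where xt: "p = (x, t)" "x \<in> X" "t \<in> I" using p by auto
  have fst: "(fst \<longlongrightarrow> x) (at p within X \<times> I)" and snd: "(snd \<longlongrightarrow> t) (at p within X \<times> I)"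
    using tendsto_fst[OF tendsto_ident_at, of p "X \<times> I"] tendsto_snd[OF tendsto_ident_at, of p "X \<times> I"]
    by (auto simp: xt)
  have ev: "\<forall>\<^sub>F q in at p within X \<times> I. q \<in> X \<times> I" by (simp add: eventually_at_filter)
  have "((\<lambda>q. f (fst q, t)) \<longlongrightarrow> f (x, t)) (at p within X \<times> I)"
  proof -
    have "continuous_on (X \<times> I) (\<lambda>q. f (fst q, t))"
      by (rule continuous_on_compose2[OF c[OF xt(3)]]) (auto intro!: continuous_intros)
    then show ?thesis using p xt unfolding continuous_on_def by fastforce
  qed
  moreover have "((\<lambda>q. f q - f (fst q, t)) \<longlongrightarrow> 0) (at p within X \<times> I)"
  proof (rule Lim_null_comparison)
    show "\<forall>\<^sub>F q in at p within X \<times> I. norm (f q - f (fst q, t)) \<le> L * \<bar>snd q - t\<bar>"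
      using ev by eventually_elim (use L xt in auto)
    have "((\<lambda>q. L * \<bar>snd q - t\<bar>) \<longlongrightarrow> L * \<bar>t - t\<bar>) (at p within X \<times> I)"
      by (intro tendsto_intros snd)
    then show "((\<lambda>q. L * \<bar>snd q - t\<bar>) \<longlongrightarrow> 0) (at p within X \<times> I)" by simp
  qed
  ultimately have "((\<lambda>q. f (fst q, t) + (f q - f (fst q, t))) \<longlongrightarrow> f (x, t) + 0) (at p within X \<times> I)"
    by (rule tendsto_add)
  then show "(f \<longlongrightarrow> f p) (at p within X \<times> I)" by (simp add: xt)
qed

text \<open>The potential is a balanced primitive of the initial data plus the time integral of
  \<open>arctan ux\<close>. Differentiating under the integral and using the equation gives back
  \<open>u\<close>; the integrand is at most \<open>pi / 2\<close> in size, whence the bound with no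
  boundary condition.\<close>

lemma flow_potential_exists:
  fixes u :: "real \<times> real \<Rightarrow> real"
  assumes sm: "smooth_on ({- 1<..<1} \<times> {t. 0 \<le> t \<and> ereal t < T}) u"
    and flow: "GCSF {- 1<..<1} T u"
    and int: "set_integrable lborel {- 1<..<1} (\<lambda>x. u (x, 0))"
    and Tm: "0 < Tm" "ereal Tm \<le> T"
  obtains ph ux ut uxt where
    "flow_potential Tm (L1_norm_on {- 1<..<1} (\<lambda>x. u (x, 0))) ph (\<lambda>x t. u (x, t)) ux ut uxt"
proof -
  let ?S = "{- 1<..<1::real} \<times> {0..<Tm}" and ?R = "{- 1<..<1} \<times> {t. 0 \<le> t \<and> ereal t < T}"
  have lt: "ereal t < T" if "t < Tm" for t using that Tm(2) by (meson ereal_less_eq less_ereal.simps(1) order_less_le_trans)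
  have sub: "?S \<subseteq> ?R" using lt by auto
  have "Ck_on (Suc (Suc 0)) ?R u" using sm unfolding smooth_on_def by blast
  then obtain u' where u': "\<And>p. p \<in> ?R \<Longrightarrow> (u has_derivative u' p) (at p within ?R)"
    and u'': "\<And>v. Ck_on (Suc 0) ?R (\<lambda>p. u' p v)" by auto
  obtain g where g: "\<And>p. p \<in> ?R \<Longrightarrow> ((\<lambda>p. u' p (1, 0)) has_derivative g p) (at p within ?R)"
    and gc: "\<And>v. continuous_on ?R (\<lambda>p. g p v)" using u''[of "(1, 0)"] by auto
  obtain h where h: "\<And>p. p \<in> ?R \<Longrightarrow> ((\<lambda>p. u' p (0, 1)) has_derivative h p) (at p within ?R)"
    and hc: "\<And>v. continuous_on ?R (\<lambda>p. h p v)" using u''[of "(0, 1)"] by auto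
  define ux ut uxx uxt where "ux p = u' p (1, 0)" and "ut p = u' p (0, 1)"
    and "uxx p = g p (1, 0)" and "uxt p = h p (1, 0)" for p
  have du: "(u has_derivative u' p) (at p within ?S)" if "p \<in> ?S" for p
    by (rule has_derivative_subset[OF u' sub]) (use sub that in auto)
  have dux: "(ux has_derivative g p) (at p within ?S)" if "p \<in> ?S" for p
    unfolding ux_def[abs_def] by (rule has_derivative_subset[OF g sub]) (use sub that in auto)
  have dut: "(ut has_derivative h p) (at p within ?S)" if "p \<in> ?S" for p
    unfolding ut_def[abs_def] by (rule has_derivative_subset[OF h sub]) (use sub that in auto)
  have cu: "continuous_on ?S u" by (rule has_derivative_continuous_on, rule du)
  have cux: "continuous_on ?S ux" by (rule has_derivative_continuous_on, rule dux)
  have cut: "continuous_on ?S ut" by (rule has_derivative_continuous_on, rule dut)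
  have cuxx: "continuous_on ?S uxx" and cuxt: "continuous_on ?S uxt"
    unfolding uxx_def[abs_def] uxt_def[abs_def] using continuous_on_subset[OF gc sub] continuous_on_subset[OF hc sub] by auto
  have u_x: "((\<lambda>y. u (y, t)) has_real_derivative ux (x, t)) (at x)"
    if "- 1 < x" "x < 1" "0 \<le> t" "t < Tm" for x t
    unfolding ux_def by (rule has_derivative_slice_x[OF du]) (use that in auto)
  have ux_x: "((\<lambda>y. ux (y, t)) has_real_derivative uxx (x, t)) (at x)"
    if "- 1 < x" "x < 1" "0 \<le> t" "t < Tm" for x t
    unfolding uxx_def by (rule has_derivative_slice_x[OF dux]) (use that in auto)
  have ut_x: "((\<lambda>y. ut (y, t)) has_real_derivative uxt (x, t)) (at x)"
    if "- 1 < x" "x < 1" "0 \<le> t" "t < Tm" for x t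
    unfolding uxt_def by (rule has_derivative_slice_x[OF dut]) (use that in auto)
  have u_t: "((\<lambda>s. u (x, s)) has_real_derivative ut (x, t)) (at t)"
    if "- 1 < x" "x < 1" "0 < t" "t < Tm" for x t
    unfolding ut_def by (rule has_derivative_slice_t[OF du]) (use that in auto)
  define k where "k p = uxx p / (1 + (ux p)\<^sup>2)" for p
  have nz: "1 + (ux p)\<^sup>2 \<noteq> 0" for p by (metis add_pos_nonneg less_irrefl zero_le_power2 zero_less_one)
  \<comment> \<open>The spatial derivatives in \<open>GCSF\<close> are only asserted to exist;
    uniqueness of derivatives identifies them with the directional derivatives of
    \<open>u\<close>.\<close>
  have pde: "ut (x, t) = k (x, t)" if x: "- 1 < x" "x < 1" and t: "0 < t" "t < Tm" for x t
  proof -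
    obtain wx wxx where w: "\<And>x t. x \<in> {- 1<..<1} \<Longrightarrow> 0 < t \<Longrightarrow> ereal t < T \<Longrightarrow>
        ((\<lambda>y. u (y, t)) has_real_derivative wx (x, t)) (at x within {- 1<..<1}) \<and>
        ((\<lambda>y. wx (y, t)) has_real_derivative wxx (x, t)) (at x within {- 1<..<1}) \<and>
        ((\<lambda>s. u (x, s)) has_real_derivative wxx (x, t) / (1 + (wx (x, t))\<^sup>2)) (at t)"
      using flow unfolding GCSF_def by blast
    have wx: "wx (y, t) = ux (y, t)" if "- 1 < y" "y < 1" for y
      using w[of y t] lt t that u_x[of y t] DERIV_unique by (auto simp: at_within_open[of y "{- 1<..<1}"])
    have "((\<lambda>y. wx (y, t)) has_real_derivative wxx (x, t)) (at x)"
      using w[of x t] lt t x by (auto simp: at_within_open[of x "{- 1<..<1}"])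
    then have "((\<lambda>y. ux (y, t)) has_real_derivative wxx (x, t)) (at x)"
      by (rule has_field_derivative_transform_within_open[where S = "{- 1<..<1}"]) (use x wx in auto)
    then have "wxx (x, t) = uxx (x, t)" using ux_x[of x t] x t DERIV_unique by auto
    moreover have "((\<lambda>s. u (x, s)) has_real_derivative wxx (x, t) / (1 + (wx (x, t))\<^sup>2)) (at t)"
      using w[of x t] lt t x by auto
    ultimately show ?thesis using u_t[OF x t] wx[of x] x DERIV_unique by (auto simp: k_def)
  qed
  have ck: "continuous_on ?S k" unfolding k_def[abs_def] using nz by (intro continuous_intros cuxx cux) auto
  have cpsi: "continuous_on ?S (\<lambda>p. arctan (ux p))" by (intro continuous_intros cux)
  have psi_x: "((\<lambda>y. arctan (ux (y, t))) has_real_derivative k (x, t)) (at x)"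
    if "- 1 < x" "x < 1" "0 \<le> t" "t < Tm" for x t
    using ux_x[OF that] nz[of "(x, t)"] by (auto intro!: derivative_eq_intros simp: k_def divide_inverse mult.commute)
  have c0: "continuous_on {- 1<..<1} (\<lambda>x. u (x, 0))"
    by (rule continuous_on_compose2[OF cu]) (use Tm in \<open>auto intro!: continuous_intros\<close>)
  obtain P where P: "\<And>x. - 1 < x \<Longrightarrow> x < 1 \<Longrightarrow> (P has_real_derivative u (x, 0)) (at x)"
    and PA: "\<And>x. - 1 < x \<Longrightarrow> x < 1 \<Longrightarrow> \<bar>P x\<bar> \<le> L1_norm_on {- 1<..<1} (\<lambda>x. u (x, 0)) / 2"
    using L1_primitive[OF int c0] by blast
  define ph where "ph p = P (fst p) + integral {0..snd p} (\<lambda>s. arctan (ux (fst p, s)))" for p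
  have ph_x: "((\<lambda>y. ph (y, t)) has_real_derivative u (x, t)) (at x)"
    if x: "- 1 < x" "x < 1" and t: "0 \<le> t" "t < Tm" for x t
  proof -
    have "integral {0..t} (\<lambda>s. k (x, s)) = u (x, t) - u (x, 0)"
      by (rule integral_of_t_derivative[OF cu _ x t]) (use u_t pde x in force)
    then have "((\<lambda>y. integral {0..t} (\<lambda>s. arctan (ux (y, s)))) has_real_derivative u (x, t) - u (x, 0)) (at x)"
      using integral_x_derivative[OF cpsi ck psi_x x t(2)] by simp
    then show ?thesis unfolding ph_def using P[OF x] by (auto intro!: derivative_eq_intros)
  qed
  have ph_t: "((\<lambda>s. ph (x, s)) has_real_derivative arctan (ux (x, t))) (at t)"
    if x: "- 1 < x" "x < 1" and t: "0 < t" "t < Tm" for x t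
    unfolding ph_def using integral_t_derivative[OF cpsi x t] by (auto intro!: derivative_eq_intros)
  \<comment> \<open>Mixed derivatives are interchanged through integrals:
    \<open>u (y, s) - u (y, 0)\<close> is the time integral of \<open>ut\<close>, and
    differentiating in \<open>y\<close> shows that \<open>ux (x, s) - ux (x, 0)\<close> is that of
    \<open>uxt\<close>.\<close>
  have ux_t: "((\<lambda>s. ux (x, s)) has_real_derivative uxt (x, t)) (at t)"
    if x: "- 1 < x" "x < 1" and t: "0 < t" "t < Tm" for x t
  proof -
    have eq: "integral {0..s} (\<lambda>s. uxt (x, s)) = ux (x, s) - ux (x, 0)" if s: "0 \<le> s" "s < Tm" for s
    proof -
      have "integral {0..s} (\<lambda>s. ut (y, s)) = u (y, s) - u (y, 0)" if "- 1 < y" "y < 1" for y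
        by (rule integral_of_t_derivative[OF cu _ that s]) (use u_t that in auto)
      moreover have "((\<lambda>y. integral {0..s} (\<lambda>s. ut (y, s))) has_real_derivative integral {0..s} (\<lambda>s. uxt (x, s))) (at x)"
        by (rule integral_x_derivative[OF cut cuxt ut_x x s(2)])
      ultimately have "((\<lambda>y. u (y, s) - u (y, 0)) has_real_derivative integral {0..s} (\<lambda>s. uxt (x, s))) (at x)"
        using x by (auto elim!: has_field_derivative_transform_within_open[where S = "{- 1<..<1}"])
      moreover have "((\<lambda>y. u (y, s) - u (y, 0)) has_real_derivative ux (x, s) - ux (x, 0)) (at x)"
        using u_x[OF x s] u_x[OF x order_refl Tm(1)] by (rule DERIV_diff)
      ultimately show ?thesis by (rule DERIV_unique)
    qed
    have "((\<lambda>s. ux (x, 0) + integral {0..s} (\<lambda>s. uxt (x, s))) has_real_derivative uxt (x, t)) (at t)"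
      using integral_t_derivative[OF cuxt x t] by (auto intro!: derivative_eq_intros)
    then show ?thesis
      by (rule has_field_derivative_transform_within_open[where S = "{0<..<Tm}"]) (use t eq in auto)
  qed
  have lip: "\<bar>ph (x, s) - ph (x, t)\<bar> \<le> pi / 2 * \<bar>s - t\<bar>" if x: "- 1 < x" "x < 1" and st: "0 \<le> s" "s \<le> t" "t < Tm" for x s t
  proof -
    have ci: "continuous_on {0..t} (\<lambda>s. arctan (ux (x, s)))"
      by (rule continuous_on_slices[OF cpsi x st(3)])
    have "integral {0..s} (\<lambda>s. arctan (ux (x, s))) + integral {s..t} (\<lambda>s. arctan (ux (x, s)))
        = integral {0..t} (\<lambda>s. arctan (ux (x, s)))"
      by (rule Henstock_Kurzweil_Integration.integral_combine) (use st ci in \<open>auto intro: integrable_continuous_real\<close>)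
    moreover have "norm (integral {s..t} (\<lambda>s. arctan (ux (x, s)))) \<le> pi / 2 * (t - s)"
    proof (rule integral_bound)
      show "norm (arctan (ux (x, r))) \<le> pi / 2" for r
        using arctan_bounded[of "ux (x, r)"] by auto
    qed (use st continuous_on_subset[OF ci] in auto)
    moreover have "ph (x, s) - ph (x, t)
        = integral {0..s} (\<lambda>s. arctan (ux (x, s))) - integral {0..t} (\<lambda>s. arctan (ux (x, s)))"
      by (simp add: ph_def)
    ultimately have "\<bar>ph (x, s) - ph (x, t)\<bar> \<le> pi / 2 * (t - s)"
      unfolding real_norm_def by linarith
    then show ?thesis using st by simp
  qed
  have "continuous_on ?S ph"
  proof (rule continuous_on_uniform_lipschitz_snd)
    show "\<bar>ph (x, s) - ph (x, t)\<bar> \<le> pi / 2 * \<bar>s - t\<bar>" if "x \<in> {- 1<..<1}" "s \<in> {0..<Tm}" "t \<in> {0..<Tm}" for x s t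
      using lip[of x s t] lip[of x t s] that by (cases "s \<le> t") (auto simp: abs_minus_commute)
    show "continuous_on {- 1<..<1} (\<lambda>x. ph (x, t))" if "t \<in> {0..<Tm}" for t
      by (rule DERIV_continuous_on, rule has_field_derivative_at_within, rule ph_x) (use that in auto)
  qed
  moreover have "\<bar>ph (x, t)\<bar> \<le> L1_norm_on {- 1<..<1} (\<lambda>x. u (x, 0)) / 2 + pi * t / 2"
    if "- 1 < x" "x < 1" "0 \<le> t" "t < Tm" for x t
    using lip[of x 0 t] PA[of x] that by (simp add: ph_def)
  moreover have "((\<lambda>y. ux (y, t)) has_real_derivative (1 + (ux (x, t))\<^sup>2) * ut (x, t)) (at x)"
    if "- 1 < x" "x < 1" "0 < t" "t < Tm" for x t
    using ux_x[of x t] pde[OF that] nz[of "(x, t)"] that by (simp add: k_def)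
  ultimately have "flow_potential Tm (L1_norm_on {- 1<..<1} (\<lambda>x. u (x, 0))) (\<lambda>x t. ph (x, t)) (\<lambda>x t. u (x, t))
      (\<lambda>x t. ux (x, t)) (\<lambda>x t. ut (x, t)) (\<lambda>x t. uxt (x, t))"
    by unfold_locales (use ph_x ph_t u_x u_t ux_t ut_x cu cux in auto)
  then show thesis by (rule that)
qed

theorem theorem1p8:
  shows "\<forall>\<delta>::real. \<delta> > 0 \<longrightarrow>
    (\<exists>C::real. \<forall>(T::ereal) (u :: real \<times> real \<Rightarrow> real).
       0 < T \<longrightarrow>
       smooth_on ({-1<..<1} \<times> {t. 0 \<le> t \<and> ereal t < T}) u \<longrightarrow>
       GCSF {-1<..<1} T u \<longrightarrow>
       set_integrable lborel {-1<..<1} (\<lambda>x. u (x, 0)) \<longrightarrow>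
       ereal (L1_norm_on {-1<..<1} (\<lambda>x. u (x, 0)) / pi) < T \<longrightarrow>
       (\<forall>t::real. ereal t < T \<and> t \<ge> (1 + \<delta>) * (L1_norm_on {-1<..<1} (\<lambda>x. u (x, 0)) / pi) \<longrightarrow>
          \<bar>u (0, t)\<bar> \<le> C + (1/2) * L1_norm_on {-1<..<1} (\<lambda>x. u (x, 0)) + pi * t / 2))"
proof (intro allI impI, goal_cases)
  case (1 \<delta>)
  \<comment> \<open>Chosen so that \<open>(1 - 8 * b)\<^sup>2 = 1 / (1 + \<delta>)\<close>: the
    condition \<open>t \<ge> (1 + \<delta>) * (A / pi)\<close> becomes
    \<open>A \<le> (1 - 8 * b)\<^sup>2 * (pi * t)\<close>.\<close>
  define b where "b = (1 - 1 / sqrt (1 + \<delta>)) / 8"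
  have sq: "1 < sqrt (1 + \<delta>)" using 1 by simp
  have b: "0 < b" "b < 1 / 8" using sq by (auto simp: b_def)
  have "1 - 8 * b = 1 / sqrt (1 + \<delta>)" by (simp add: b_def diff_divide_distrib)
  then have b2: "(1 - 8 * b)\<^sup>2 = 1 / (1 + \<delta>)" using 1 by (simp add: power_divide)
  show ?case
  proof (intro exI[of _ "center_const b"] allI impI, elim conjE, goal_cases)
    case (1 T u t)
    define A where "A = L1_norm_on {- 1<..<1} (\<lambda>x. u (x, 0))"
    have A0: "0 \<le> A" unfolding A_def L1_norm_on_def set_lebesgue_integral_def
      by (intro integral_nonneg_AE) auto
    have bound: "\<bar>u (0, t)\<bar> \<le> center_const b + A / 2 + pi * t / 2"
      if t: "0 < t" "ereal t < T" "(1 + \<delta>) * (A / pi) \<le> t" for t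
    proof -
      \<comment> \<open>A real lifetime between \<open>t\<close> and the possibly infinite
        \<open>T\<close>.\<close>
      obtain Tm where Tm: "ereal t < ereal Tm" "ereal Tm < T" using t(2) ereal_dense2 by blast
      obtain ph ux ut uxt where F: "flow_potential Tm A ph (\<lambda>x t. u (x, t)) ux ut uxt"
        unfolding A_def by (rule flow_potential_exists[of T u Tm]) (use 1 Tm t in auto)
      have "A \<le> (1 - 8 * b)\<^sup>2 * (pi * t)"
        unfolding b2 using t(3) \<open>\<delta> > 0\<close> by (simp add: field_simps)
      then show ?thesis using abs_u_center_le[OF F b t(1) _ A0] Tm by simp
    qed
    have t0: "0 \<le> t"
      using 1(7) A0 \<open>\<delta> > 0\<close> unfolding A_def[symmetric]
      by (smt (verit, best) divide_nonneg_pos mult_nonneg_nonneg pi_gt_zero)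
    have "\<bar>u (0, t)\<bar> \<le> center_const b + A / 2 + pi * t / 2"
    proof (cases "t = 0")
      case False
      then show ?thesis using bound[of t] t0 1 by (simp add: A_def)
    next
      \<comment> \<open>At \<open>t = 0\<close> the threshold is at most \<open>0\<close>, so every
        positive time before \<open>T\<close> is admissible, and the bound passes to the limit by
        continuity of \<open>u\<close> up to the initial time.\<close>
      case True
      obtain Tm where Tm: "0 < ereal Tm" "ereal Tm < T" using \<open>0 < T\<close> ereal_dense2 by blast
      obtain ph ux ut uxt where F: "flow_potential Tm A ph (\<lambda>x t. u (x, t)) ux ut uxt"
        unfolding A_def by (rule flow_potential_exists[of T u Tm]) (use 1 Tm in auto)
      interpret flow_potential Tm A ph "\<lambda>x t. u (x, t)" ux ut uxt by (rule F)
      have "continuous_on {0..Tm / 2} (\<lambda>s. (0 :: real, s))" by (intro continuous_intros)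
      moreover have "(\<lambda>s. (0 :: real, s)) ` {0..Tm / 2} \<subseteq> {- 1<..<1} \<times> {0..<Tm}" using Tm by auto
      ultimately have "continuous_on {0..Tm / 2} (\<lambda>s. u (0, s))"
        using continuous_on_compose2[OF cont(2)] by fastforce
      then have "((\<lambda>s. u (0, s)) \<longlongrightarrow> u (0, 0)) (at 0 within {0..Tm / 2})"
        using Tm by (auto simp: continuous_on_def)
      then have lim: "((\<lambda>s. u (0, s)) \<longlongrightarrow> u (0, 0)) (at_right 0)"
        using Tm by (simp add: at_within_Icc_at_right)
      have "\<bar>u (0, 0)\<bar> \<le> center_const b + A / 2 + pi * 0 / 2"
      proof (rule tendsto_le)
        show "((\<lambda>s. \<bar>u (0, s)\<bar>) \<longlongrightarrow> \<bar>u (0, 0)\<bar>) (at_right 0)" by (intro tendsto_intros lim)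
        show "((\<lambda>s. center_const b + A / 2 + pi * s / 2) \<longlongrightarrow> center_const b + A / 2 + pi * 0 / 2) (at_right 0)"
          by (intro tendsto_intros) auto
        have "\<forall>\<^sub>F s in at_right 0. s \<in> {0<..<Tm}" by (rule eventually_at_right_real) (use Tm in simp)
        then show "\<forall>\<^sub>F s in at_right 0. \<bar>u (0, s)\<bar> \<le> center_const b + A / 2 + pi * s / 2"
        proof eventually_elim
          case (elim s)
          then have "ereal s < T" using Tm by (meson ereal_less_eq greaterThanLessThan_iff less_ereal.simps(1) less_trans)
          then show ?case using elim 1(7) True unfolding A_def[symmetric] by (intro bound) auto
        qed
      qed simp
      then show ?thesis by (simp add: True)
    qed
    then show ?case by (simp add: A_def)
  qed
qed

end
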